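(* Let $X=\{1,2\}$ with $1\prec 2$, and let $i,j\ge 0$. Expand the shuffle type polynomial $\mathcal{SH}_{i,j}(E_2,E_1)$ in the PBW basis of Lyndon–Shirshov monomials. Let $E_{\alpha_1}^{t_{\alpha_1}}\cdots E_{\alpha_n}^{t_{\alpha_n}}$ be a term of this expansion, where $\alpha_1\succ\cdots\succ\alpha_n$ are Lyndon words, $t_{\alpha_k}\in\mathbb{N}$ ($1\le k\le n$), $i=\sum_{k=1}^n t_{\alpha_k}\alpha_k(2)$ and $j=\sum_{k=1}^n t_{\alpha_k}\alpha_k(1)$. Then its coefficient in $\mathcal{SH}_{i,j}(E_2,E_1)$ is $$C_{E_{\alpha_1}^{t_{\alpha_1}}\cdots E_{\alpha_n}^{t_{\alpha_n}}}=\frac{(i+j)!}{\prod_{k=1}^n(|\alpha_k|!)^{t_{\alpha_k}}\,t_{\alpha_k}!}\prod_{k=1}^n C_{E_{\alpha_k}}^{t_{\alpha_k}},$$ where $i+j=\sum_{k=1}^n|\alpha_k|t_{\alpha_k}$ and $C_{E_{\alpha_k}}$ denotes the coefficient of the basis element $E_{\alpha_k}$ in the expansion of $\mathcal{SH}_{\alpha_k(2),\alpha_k(1)}(E_2,E_1)$.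
   Context: Let $X$ be a totally ordered set and $\langle X\rangle$ the free monoid of words on $X$. The lexicographic order on words: $\alpha\prec\beta$ iff $\alpha$ is a proper prefix of $\beta$, or $\alpha=\gamma x\eta$, $\beta=\gamma y\zeta$ with letters $x\prec y$. For a word $\alpha$, $|\alpha|$ is its length and $\alpha(x)$ the number of occurrences of the letter $x$. A nonempty word $\alpha$ is a Lyndon word if it is a single letter, or if whenever $\alpha=\beta\gamma$ with $\beta,\gamma$ nonempty one has $\alpha\prec\gamma\beta$. For a Lyndon word $\alpha$ that is not a letter, its standard factorization is $\alpha=\alpha_L\alpha_R$ where $\alpha_R$ is the longest proper suffix of $\alpha$ that is a Lyndon word (then $\alpha_L$ is Lyndon). In the free associative algebra $\mathds{k}\langle X\rangle$ define $E_x=x$ for letters $x$ and recursively $E_\alpha=[E_{\alpha_L},E_{\alpha_R}]=E_{\alpha_L}E_{\alpha_R}-E_{\alpha_R}E_{\alpha_L}$. The monomials $E_{\alpha_1}^{t_1}\cdots E_{\alpha_n}^{t_n}$ ($n\ge0$, $\alpha_1\succ\cdots\succ\alpha_n$ Lyndon, $t_k\ge1$) form a basis (the PBW basis) of $\mathds{k}\langle X\rangle$; a "term" of an element is a monomial of this basis occurring in its expansion. For letters (variables) $y,x$, the shuffle type polynomial $\mathcal{SH}_{i,j}(y,x)$ is the sum of all words in $y,x$ containing exactly $i$ letters $y$ and $j$ letters $x$ (so $(x+y)^n=\sum_{k=0}^n\mathcal{SH}_{k,n-k}(y,x)$). The expansions are computed with integer coefficients (in $\mathbb{Z}\langle X\rangle$);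 over a field $\mathds{k}$ the coefficients are the images of these integers. *)

theory Defs
  imports
    Complex_Main
    "HOL-Library.List_Lexorder"
    "HOL-Library.Sublist"
    "HOL-Library.Poly_Mapping"
begin

section \<open>The free monoid and the free associative algebra\<close>

text \<open>
  Words over \<open>'x\<close> are lists, ordered by \<^theory>\<open>HOL-Library.List_Lexorder\<close> (a proper prefix is
  smaller; otherwise the first difference decides). Making concatenation the additive monoid
  structure on lists lets the convolution product of \<^theory>\<open>HOL-Library.Poly_Mapping\<close> turn
  \<open>'x list \<Rightarrow>\<^sub>0 'k\<close> into the monoid algebra of the free monoid, i.e. the free associative algebra.
\<close>

instantiation list :: (type) monoid_add
begin

definition zero_list :: "'a list" where "zero_list = []"

definition plus_list :: "'a list \<Rightarrow> 'a list \<Rightarrow> 'a list" where "plus_list u v = u @ v"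

instance by standard (simp_all add: zero_list_def plus_list_def)

end

type_synonym ('x, 'k) free_alg = "'x list \<Rightarrow>\<^sub>0 'k"

abbreviation var :: "'x \<Rightarrow> ('x, 'k::comm_ring_1) free_alg" where
  "var x \<equiv> Poly_Mapping.single [x] 1"

definition free_scale :: "'k::comm_ring_1 \<Rightarrow> ('x, 'k) free_alg \<Rightarrow> ('x, 'k) free_alg" where
  "free_scale c f = Poly_Mapping.map ((*) c) f"

lemma lookup_free_scale: "Poly_Mapping.lookup (free_scale c f) w = c * Poly_Mapping.lookup f w"
  by (simp add: free_scale_def Poly_Mapping.map.rep_eq when_def)

global_interpretation free_alg: module free_scale
  by standard
    (auto intro!: poly_mapping_eqI simp: lookup_free_scale lookup_add algebra_simps)


section \<open>Lyndon words and their bracketings\<close>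

definition lyndon :: "'x::linorder list \<Rightarrow> bool" where
  "lyndon w \<longleftrightarrow> w \<noteq> [] \<and>
     (length w = 1 \<or> (\<forall>u v. u \<noteq> [] \<and> v \<noteq> [] \<and> w = u @ v \<longrightarrow> w < v @ u))"

definition std_right :: "'x::linorder list \<Rightarrow> 'x list" where
  "std_right w = (ARG_MAX length v. strict_suffix v w \<and> lyndon v)"

definition std_left :: "'x::linorder list \<Rightarrow> 'x list" where
  "std_left w = take (length w - length (std_right w)) w"

lemma std_right_props:
  assumes "length w > 1"
  shows "strict_suffix (std_right w) w" and "lyndon (std_right w)"
proof -
  let ?P = "\<lambda>v. strict_suffix v w \<and> lyndon v"
  have "w = butlast w @ [last w]"
    using assms by (cases w) simp_all
  moreover have "[last w] \<noteq> w"
    using assms by (metis One_nat_def length_Cons less_irrefl list.size(3))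
  ultimately have "?P [last w]"
    unfolding strict_suffix_def suffix_def lyndon_def by auto
  moreover have "\<forall>v. ?P v \<longrightarrow> length v < Suc (length w)"
    by (auto dest: suffix_length_le simp: strict_suffix_def)
  ultimately have "?P (std_right w)"
    unfolding std_right_def by (rule arg_max_natI)
  then show "strict_suffix (std_right w) w" and "lyndon (std_right w)"
    by auto
qed

lemma std_lengths:
  assumes "length w > 1"
  shows "length (std_right w) < length w" and "length (std_left w) < length w"
proof -
  show "length (std_right w) < length w"
    using std_right_props(1)[OF assms]
    by (simp add: suffix_order.strict_iff_order suffix_length_less)
  have "length (std_right w) > 0"
    using std_right_props(2)[OF assms] by (simp add: lyndon_def)
  then show "length (std_left w) < length w"
    using assms unfolding std_left_def length_take by linarith
qed

lemma std_factorization: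
  assumes "length w > 1"
  shows "std_left w @ std_right w = w"
proof -
  obtain u where "w = u @ std_right w"
    using std_right_props(1)[OF assms] by (auto simp: strict_suffix_def suffix_def)
  moreover from this have "length w = length u + length (std_right w)"
    by (metis length_append)
  ultimately show ?thesis
    unfolding std_left_def by (metis add_diff_cancel_right' append_eq_conv_conj)
qed

text \<open>The recursion makes sense for every word; it is only used on Lyndon words.\<close>

function bracketing :: "'x::linorder list \<Rightarrow> ('x, 'k::comm_ring_1) free_alg" where
  "bracketing w =
     (if length w \<le> 1 then Poly_Mapping.single w 1
      else bracketing (std_left w) * bracketing (std_right w)
         - bracketing (std_right w) * bracketing (std_left w))"
  by pat_completeness auto
termination
  by (relation "measure length") (simp_all add: std_lengths)

declare bracketing.simps [simp del]

lemma bracketing_letter: "bracketing [x] = var x"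
  by (simp add: bracketing.simps)


section \<open>The PBW basis\<close>

definition pbw_index :: "nat \<Rightarrow> (nat \<Rightarrow> 'x::linorder list) \<Rightarrow> (nat \<Rightarrow> nat) \<Rightarrow> bool" where
  "pbw_index n \<alpha> t \<longleftrightarrow>
     (\<forall>k\<in>{1..n}. lyndon (\<alpha> k) \<and> t k \<ge> 1) \<and>
     (\<forall>k\<in>{1..n}. \<forall>l\<in>{1..n}. k < l \<longrightarrow> \<alpha> k > \<alpha> l)"

definition pbw_monomial ::
    "nat \<Rightarrow> (nat \<Rightarrow> 'x::linorder list) \<Rightarrow> (nat \<Rightarrow> nat) \<Rightarrow> ('x, 'k::comm_ring_1) free_alg" where
  "pbw_monomial n \<alpha> t = (\<Prod>k\<leftarrow>[1..<Suc n]. bracketing (\<alpha> k) ^ t k)"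

definition pbw_basis :: "('x::linorder, 'k::comm_ring_1) free_alg set" where
  "pbw_basis = {pbw_monomial n \<alpha> t | n \<alpha> t. pbw_index n \<alpha> t}"

definition pbw_coeff ::
    "('x::linorder, 'k::comm_ring_1) free_alg \<Rightarrow> ('x, 'k) free_alg \<Rightarrow> 'k" where
  "pbw_coeff f b = free_alg.representation pbw_basis f b"


section \<open>Shuffle type polynomials\<close>

text \<open>
  The sum ranges over words in two formal variables: \<^term>\<open>True\<close> stands for \<open>y\<close>,
  \<^term>\<open>False\<close> for \<open>x\<close>.
\<close>

definition shuffle_poly :: "nat \<Rightarrow> nat \<Rightarrow> 'a::semiring_1 \<Rightarrow> 'a \<Rightarrow> 'a" where
  "shuffle_poly i j y x =
     (\<Sum>w | count_list w True = i \<and> count_list w False = j. \<Prod>b\<leftarrow>w. if b then y else x)"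


section \<open>The two-letter alphabet\<close>

datatype letter = L1 | L2

instantiation letter :: linorder
begin

definition less_letter :: "letter \<Rightarrow> letter \<Rightarrow> bool" where
  "a < b \<longleftrightarrow> a = L1 \<and> b = L2"

definition less_eq_letter :: "letter \<Rightarrow> letter \<Rightarrow> bool" where
  "a \<le> b \<longleftrightarrow> a = L1 \<or> b = L2"

instance
proof
  fix a b c :: letter
  show "a < b \<longleftrightarrow> a \<le> b \<and> \<not> b \<le> a" "a \<le> a" "a \<le> b \<Longrightarrow> b \<le> c \<Longrightarrow> a \<le> c"
    "a \<le> b \<Longrightarrow> b \<le> a \<Longrightarrow> a = b" "a \<le> b \<or> b \<le> a"
    by (cases a; cases b; cases c; simp add: less_letter_def less_eq_letter_def)+
qed

end

definition SH :: "nat \<Rightarrow> nat \<Rightarrow> (letter, 'k::comm_ring_1) free_alg" where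
  "SH i j = shuffle_poly i j (bracketing [L2]) (bracketing [L1])"

end

theory Submission
  imports Defs "HOL-Library.Multiset"
begin

text \<open>
  For a Lyndon word \<open>w\<close>, the bracketing \<open>E\<^sub>w\<close> is \<open>w\<close> plus larger words with the same letters, so by
  the unique factorization of words into nonincreasing Lyndon words the PBW monomials are
  unitriangular over the words, and hence a basis over every commutative ring.

  Let \<open>\<Delta>\<close> be the coproduct making the letters primitive. Every \<open>E\<^sub>w\<close> is primitive. If \<open>\<phi>\<close> is
  the coefficient functional of \<open>E\<^sub>l\<close>, then \<open>(\<phi> \<otimes> id) \<circ> \<Delta>\<close> removes one factor \<open>E\<^sub>l\<close> from a PBW
  monomial and multiplies it by the multiplicity of that factor, while it sends \<open>s ^ N\<close>, for \<open>s\<close>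
  the sum of the letters, to a sum of \<open>(N choose m) \<phi>(s ^ m) s ^ (N - m)\<close>, in which only
  \<open>m = |l|\<close> survives. Comparing coefficients peels off the largest Lyndon factor, and the
  formula follows by induction. Here \<open>SH i j\<close> is the bihomogeneous component of \<open>s ^ (i + j)\<close>.
\<close>

section \<open>Lyndon factorizations\<close>

lemma append_less_append_iff [simp]: "x @ u < x @ v \<longleftrightarrow> u < (v :: 'a::order list)"
  by (induction x) auto

lemma less_append_right: "v \<noteq> [] \<Longrightarrow> u < u @ (v :: 'a::order list)"
  by (induction u) (auto simp: neq_Nil_conv)

text \<open>Since \<open>w\<close> is not longer than \<open>u\<close>, \<open>u\<close> is no
  proper prefix of \<open>w\<close>; a letter inside both words decides the comparison, whatever
  follows.\<close>

lemma append_less_appendI: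
  "u < w \<Longrightarrow> length w \<le> length u \<Longrightarrow> u @ v < w @ (z :: 'a::order list)"
  unfolding list_less_def by (rule lexord_sufI)

lemma less_not_prefix_append:
  "u < v \<Longrightarrow> \<not> prefix u v \<Longrightarrow> u @ x < v @ (y :: 'a::order list)"
proof (induction u arbitrary: v)
  case (Cons a u)
  then show ?case by (cases v) auto
qed simp

section \<open>Lyndon words: rotations, suffixes and products\<close>

lemma lyndon_less_rotation:
  assumes "lyndon (u @ v)" "u \<noteq> []" "v \<noteq> []"
  shows "u @ v < v @ u"
proof -
  have "length u \<noteq> 0" "length v \<noteq> 0"
    using assms by simp_all
  then have "length (u @ v) \<noteq> 1"
    unfolding length_append by linarith
  then show ?thesis
    using assms unfolding lyndon_def by blast
qed

text \<open>Suppose \<open>v < w\<close>. If \<open>v\<close> is not a prefix of \<open>w\<close>,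
  the rotation \<open>v @ u\<close> is below \<open>w\<close>. If \<open>w = v @ u'\<close>,
  cancelling \<open>v\<close> in \<open>w < v @ u\<close> gives \<open>u' < u\<close> with equal
  lengths, so the rotation \<open>u' @ v\<close> is below \<open>w\<close>.\<close>

lemma less_suffix_if_lyndon:
  assumes "lyndon w" "w = u @ v" "u \<noteq> []" "v \<noteq> []"
  shows "w < v"
proof -
  have rot: "b @ a > w" if "w = a @ b" "a \<noteq> []" "b \<noteq> []" for a b
    using assms(1) that lyndon_less_rotation by blast
  show ?thesis
  proof (rule ccontr)
    assume "\<not> w < v"
    moreover have "v \<noteq> w"
      using assms by simp
    ultimately have vw: "v < w"
      by simp
    show False
    proof (cases "prefix v w")
      case True
      then obtain u' where w: "w = v @ u'"
        by (auto simp: prefix_def)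
      then have len: "length u' = length u"
        using assms(2) by (metis add.commute add_left_imp_eq length_append)
      have "v @ u' < v @ u"
        using rot[OF assms(2-4)] w by simp
      then have "u' @ v < u @ v"
        using len by (intro append_less_appendI) auto
      moreover have "w < u' @ v"
        using w len assms(3,4) by (intro rot) auto
      ultimately show False
        using assms(2) by simp
    next
      case False
      then have "v @ u < w @ []"
        using vw less_not_prefix_append by blast
      with rot[OF assms(2-4)] show False
        by simp
    qed
  qed
qed

lemma lyndonI:
  assumes "w \<noteq> []" and "\<And>u v. w = u @ v \<Longrightarrow> u \<noteq> [] \<Longrightarrow> v \<noteq> [] \<Longrightarrow> w < v"
  shows "lyndon w"
  unfolding lyndon_def
proof (intro conjI disjI2 allI impI)
  fix u v assume *: "u \<noteq> [] \<and> v \<noteq> [] \<and> w = u @ v"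
  then have "w < v" "length v \<le> length w"
    using assms(2) by auto
  then show "w < v @ u"
    using append_less_appendI[of w v "[]" u] by simp
qed fact

text \<open>The critical suffix is \<open>v\<close>. If \<open>v = u @ v'\<close>, then
  \<open>u @ v < v\<close> reduces to \<open>v < v'\<close>, true because \<open>v'\<close> is a
  proper suffix of a Lyndon word. Shorter suffixes lie above \<open>v\<close>, and a longer one
  \<open>s @ v\<close> is handled by \<open>u < s\<close>.\<close>

lemma lyndon_append:
  assumes "lyndon u" "lyndon v" "u < v"
  shows "lyndon (u @ v)"
proof (rule lyndonI)
  have ne: "u \<noteq> []" "v \<noteq> []"
    using assms by (auto simp: lyndon_def)
  then show "u @ v \<noteq> []"
    by simp
  have uv: "u @ v < v"
  proof (cases "prefix u v")
    case True
    then obtain v' where v': "v = u @ v'"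
      by (auto simp: prefix_def)
    then have "v < v'"
      using ne assms by (intro less_suffix_if_lyndon[of v u v']) auto
    then show ?thesis
      by (subst (2) v') simp
  next
    case False
    then show ?thesis
      using less_not_prefix_append[OF assms(3), of v "[]"] by simp
  qed
  fix a b assume ab: "u @ v = a @ b" "a \<noteq> []" "b \<noteq> []"
  then consider s where "u = a @ s" "b = s @ v" | s where "v = s @ b"
    by (auto simp: append_eq_append_conv2)
  then show "u @ v < b"
  proof cases
    case 1
    show ?thesis
    proof (cases "s = []")
      case False
      then have "u < s"
        using less_suffix_if_lyndon[OF assms(1) 1(1)] ab by simp
      then show ?thesis
        using 1 append_less_appendI[of u s v v] by simp
    qed (use 1 uv in simp)
  next
    case 2
    then have "v \<le> b"
      using less_suffix_if_lyndon[OF assms(2) 2] ab by (cases "s = []") auto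
    then show ?thesis
      using uv by simp
  qed
qed

section \<open>Unique factorization into nonincreasing Lyndon words\<close>

definition lyndon_seq :: "'x::linorder list list \<Rightarrow> bool" where
  "lyndon_seq ls \<longleftrightarrow> sorted_wrt (\<ge>) ls \<and> (\<forall>l\<in>set ls. lyndon l)"

lemma lyndon_seq_Nil [simp]: "lyndon_seq []"
  by (simp add: lyndon_seq_def)

lemma lyndon_seq_Cons:
  "lyndon_seq (l # ls) \<longleftrightarrow> lyndon l \<and> (\<forall>m\<in>set ls. m \<le> l) \<and> lyndon_seq ls"
  by (auto simp: lyndon_seq_def)

text \<open>If \<open>l\<close> is below the head, both merge into one Lyndon word, which is
  inserted in turn; otherwise \<open>l\<close> may stand in front.\<close>

lemma lyndon_seq_insert:
  assumes "lyndon l" "lyndon_seq ls"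
  shows "\<exists>ms. lyndon_seq ms \<and> concat ms = l @ concat ls"
  using assms
proof (induction ls arbitrary: l)
  case Nil
  then show ?case
    by (intro exI[of _ "[l]"]) (simp add: lyndon_seq_Cons)
next
  case (Cons m ls)
  show ?case
  proof (cases "l < m")
    case True
    then have "lyndon (l @ m)"
      using Cons by (simp add: lyndon_append lyndon_seq_Cons)
    then show ?thesis
      using Cons by (force simp: lyndon_seq_Cons)
  next
    case False
    then show ?thesis
      using Cons.prems by (intro exI[of _ "l # m # ls"]) (auto simp: lyndon_seq_Cons)
  qed
qed

lemma lyndon_letter [simp]: "lyndon [x]"
  by (simp add: lyndon_def)

lemma lyndon_seq_exists: "\<exists>ls. lyndon_seq ls \<and> concat ls = w"
proof (induction w)
  case Nil
  show ?case
    by (intro exI[of _ "[]"]) simp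
next
  case (Cons x w)
  then obtain ls where "lyndon_seq ls" "concat ls = w"
    by blast
  then show ?case
    using lyndon_seq_insert[of "[x]" ls] by simp
qed

text \<open>The part of \<open>q\<close> inside the last factor it reaches is a nonempty prefix of
  that factor, hence at most \<open>M\<close>.\<close>

lemma small_suffix_of_prefix_concat:
  assumes "prefix q (concat ms)" "q \<noteq> []" "\<forall>m\<in>set ms. m \<le> M"
  shows "\<exists>s. suffix s q \<and> s \<noteq> [] \<and> s \<le> (M :: 'x::linorder list)"
  using assms
proof (induction ms arbitrary: q)
  case (Cons m ms)
  show ?case
  proof (cases "prefix q m")
    case True
    then have "q \<le> m"
      by (metis less_append_right list_le_def append_Nil2 prefix_def)
    then show ?thesis
      using Cons.prems by force
  next
    case False
    then obtain q' where "q = m @ q'" "q' \<noteq> []" "prefix q' (concat ms)"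
      using Cons.prems by (auto simp: prefix_append)
    then show ?thesis
      using Cons.IH[of q'] Cons.prems by (auto intro: suffix_appendI)
  qed
qed simp

text \<open>If \<open>l\<close> reached beyond \<open>m\<close>, it would have a proper suffix
  \<open>s\<close> with \<open>s \<le> m < l\<close>, whereas a Lyndon word is below its proper
  suffixes. By symmetry the heads of two factorizations agree.\<close>

lemma lyndon_seq_heads_not_longer:
  assumes "lyndon l" "lyndon_seq (m # ms)" "concat (m # ms) = l @ r"
  shows "length l \<le> length m"
proof (rule ccontr)
  assume "\<not> length l \<le> length m"
  then obtain q where q: "l = m @ q" "q \<noteq> []"
    using assms(3) by (auto simp: append_eq_append_conv2)
  then have "prefix q (concat ms)"
    using assms(3) by auto
  then obtain s where s: "suffix s q" "s \<noteq> []" "s \<le> m"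
    using small_suffix_of_prefix_concat[of q ms m] q assms(2) by (auto simp: lyndon_seq_Cons)
  then obtain a where a: "q = a @ s"
    by (auto simp: suffix_def)
  have "m \<noteq> []"
    using assms(2) by (auto simp: lyndon_seq_Cons lyndon_def)
  then have "l < s"
    using a q s less_suffix_if_lyndon[OF assms(1), of "m @ a" s] by simp
  moreover have "m < l"
    using q by (simp add: less_append_right)
  ultimately show False
    using s(3) by simp
qed

lemma lyndon_seq_unique:
  assumes "lyndon_seq ls" "lyndon_seq ms" "concat ls = concat ms"
  shows "ls = ms"
  using assms
proof (induction ls arbitrary: ms)
  case Nil
  then show ?case
    by (cases ms) (auto simp: lyndon_seq_Cons lyndon_def)
next
  case (Cons l ls)
  then obtain m ms' where ms: "ms = m # ms'"
    by (cases ms) (auto simp: lyndon_seq_Cons lyndon_def)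
  have "length l \<le> length m"
    using Cons.prems ms lyndon_seq_heads_not_longer[of l m ms' "concat ls"]
    by (simp add: lyndon_seq_Cons)
  moreover have "length m \<le> length l"
    using Cons.prems ms lyndon_seq_heads_not_longer[of m l ls "concat ms'"]
    by (simp add: lyndon_seq_Cons)
  ultimately show ?case
    using Cons ms by (auto simp: lyndon_seq_Cons)
qed

lemma lyndon_seq_mset_eq:
  assumes "lyndon_seq ls" "lyndon_seq ms" "mset ls = mset ms"
  shows "ls = ms"
proof -
  have "sort ls = rev ms" "sort ls = rev ls"
    using assms by (intro properties_for_sort; simp add: lyndon_seq_def sorted_wrt_rev)+
  then show ?thesis
    by simp
qed

text \<open>Factor \<open>u = std_left w\<close> into nonincreasing Lyndon words, with first factor
  \<open>k\<close> and last factor \<open>l\<close>, and suppose there are at least two. If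
  \<open>l < v\<close>, then \<open>l @ v\<close> is a Lyndon suffix longer than
  \<open>std_right w\<close>. Otherwise \<open>v \<le> l \<le> k\<close>, and \<open>k\<close> is a
  proper prefix of \<open>w\<close>, against \<open>w < v\<close>.\<close>

lemma lyndon_std_left:
  assumes "lyndon w" "length w > 1"
  shows "lyndon (std_left w)"
proof -
  define u v where "u = std_left w" and "v = std_right w"
  have uv: "u @ v = w" and v: "lyndon v"
    using std_factorization std_right_props assms by (auto simp: u_def v_def)
  have max: "length s \<le> length v" if "strict_suffix s w" "lyndon s" for s
    unfolding std_right_def v_def
    by (rule arg_max_nat_le[of _ _ _ "length w"])
      (use that in \<open>auto dest: suffix_length_le simp: strict_suffix_def suffix_def\<close>)
  have "u \<noteq> []"
    using uv std_right_props(1)[OF assms(2)] by (auto simp: v_def)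
  obtain ls where ls: "lyndon_seq ls" "concat ls = u"
    using lyndon_seq_exists by blast
  with \<open>u \<noteq> []\<close> obtain l ls' where ls': "ls = ls' @ [l]"
    by (cases ls rule: rev_exhaust) auto
  have l: "lyndon l"
    using ls ls' by (simp add: lyndon_seq_def)
  show ?thesis
  proof (cases ls')
    case Nil
    then show ?thesis
      using l ls ls' by (simp add: u_def)
  next
    case (Cons k ks)
    have k: "lyndon k" "l \<le> k"
      using ls ls' Cons by (auto simp: lyndon_seq_def)
    then have "k \<noteq> []"
      by (simp add: lyndon_def)
    have w: "w = k @ concat ks @ l @ v"
      using uv ls ls' Cons by (metis append.assoc concat.simps concat_append append_Nil2)
    show ?thesis
    proof (cases "l < v")
      case True
      then have "lyndon (l @ v)"
        using l v by (intro lyndon_append)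
      moreover have "strict_suffix (l @ v) w"
        using \<open>k \<noteq> []\<close>
        by (subst w) (auto simp: strict_suffix_def suffix_def intro!: exI[of _ "k @ concat ks"])
      ultimately have "l = []"
        using max by fastforce
      with l show ?thesis
        by (simp add: lyndon_def)
    next
      case False
      then have "v \<le> k"
        using k by simp
      also have "k < w"
        using v by (subst w) (auto simp: lyndon_def intro: less_append_right)
      also have "w < v"
        using less_suffix_if_lyndon[OF assms(1) uv[symmetric]] \<open>u \<noteq> []\<close> v
        by (auto simp: lyndon_def)
      \<comment> \<open>The chain yields both \<open>v < w\<close> and \<open>w < v\<close>, a
        contradiction that proves any goal.\<close>
      finally show ?thesis .
    qed
  qed
qed

section \<open>The PBW theorem for the free algebra\<close>

abbreviation mon :: "'x list \<Rightarrow> ('x, 'k::comm_ring_1) free_alg" where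
  "mon w \<equiv> Poly_Mapping.single w 1"

section \<open>Expansion of elements into words\<close>

lemma free_scale_single: "free_scale c (Poly_Mapping.single w d) = Poly_Mapping.single w (c * d)"
  by (intro poly_mapping_eqI) (simp add: lookup_free_scale lookup_single when_def)

lemma single_mult_single:
  "Poly_Mapping.single u c * Poly_Mapping.single v d = Poly_Mapping.single (u @ v) (c * d)"
  by (simp add: mult_single plus_list_def)

lemma mon_Nil: "mon [] = 1"
  by (metis single_one zero_list_def)

lemma free_alg_expand:
  "f = (\<Sum>w\<in>Poly_Mapping.keys f. free_scale (Poly_Mapping.lookup f w) (mon w))"
proof (intro poly_mapping_eqI)
  fix u
  have "(\<Sum>w\<in>Poly_Mapping.keys f. Poly_Mapping.lookup f w * (1 when w = u)) =
      (\<Sum>w\<in>Poly_Mapping.keys f. if w = u then Poly_Mapping.lookup f u else 0)"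
    by (intro sum.cong) (auto simp: when_def)
  then show "Poly_Mapping.lookup f u =
      Poly_Mapping.lookup (\<Sum>w\<in>Poly_Mapping.keys f. free_scale (Poly_Mapping.lookup f w) (mon w)) u"
    by (simp add: lookup_sum lookup_free_scale lookup_single not_in_keys_iff_lookup_eq_zero)
qed

lemma free_alg_induct [case_names single add]:
  fixes f :: "('x, 'k::comm_ring_1) free_alg"
  assumes single: "\<And>w c. P (Poly_Mapping.single w c)" and add: "\<And>f g. P f \<Longrightarrow> P g \<Longrightarrow> P (f + g)"
  shows "P f"
proof -
  have zero: "P 0"
    using single[of undefined 0] by simp
  have "P (\<Sum>w\<in>A. free_scale (Poly_Mapping.lookup f w) (mon w))" if "finite A" for A
    using that by induction (simp_all add: zero single add free_scale_single)
  then show ?thesis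
    by (subst free_alg_expand) simp
qed

lemma free_scale_mult_right: "f * free_scale c g = free_scale c (f * g)"
proof (induction f rule: free_alg_induct)
  case (single u a)
  show ?case
    by (induction g rule: free_alg_induct)
      (simp_all add: free_scale_single single_mult_single mult_ac free_alg.scale_right_distrib
        distrib_left)
qed (simp add: free_alg.scale_right_distrib distrib_right)

section \<open>Supports and leading words\<close>

lemma keys_minusD: "u \<in> Poly_Mapping.keys (f - g) \<Longrightarrow> u \<in> Poly_Mapping.keys f \<or> u \<in> Poly_Mapping.keys g"
  by (auto simp: in_keys_iff lookup_minus)

lemma keys_addD: "u \<in> Poly_Mapping.keys (f + g) \<Longrightarrow> u \<in> Poly_Mapping.keys f \<or> u \<in> Poly_Mapping.keys g"
  using subsetD[OF keys_add, of u f g] by simp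

lemma keys_multD:
  assumes "u \<in> Poly_Mapping.keys (f * g)"
  shows "\<exists>a\<in>Poly_Mapping.keys f. \<exists>b\<in>Poly_Mapping.keys g. u = a @ b"
  using subsetD[OF keys_mult assms] by (auto simp: plus_list_def)

text \<open>Unitriangularity: subtracting \<open>mon w\<close> and demanding the strict
  \<open>w < u\<close> encodes that \<open>w\<close> has coefficient 1. Equal content makes all
  words of \<open>f\<close> equally long and confines them to a finite set.\<close>

definition lead :: "('x::linorder, 'k::comm_ring_1) free_alg \<Rightarrow> 'x list \<Rightarrow> bool" where
  "lead f w \<longleftrightarrow> (\<forall>u\<in>Poly_Mapping.keys (f - mon w). mset u = mset w \<and> w < u)"

lemma lead_lookup:
  assumes "lead f w"
  shows "Poly_Mapping.lookup f w = 1"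
proof -
  have "w \<notin> Poly_Mapping.keys (f - mon w)"
    using assms by (auto simp: lead_def)
  then show ?thesis
    by (simp add: in_keys_iff lookup_minus)
qed

lemma lead_keys:
  assumes "lead f w" "u \<in> Poly_Mapping.keys f"
  shows "mset u = mset w" "w \<le> u"
proof -
  have "u \<in> Poly_Mapping.keys (f - mon w)" if "u \<noteq> w"
    using assms(2) that by (simp add: in_keys_iff lookup_minus lookup_single)
  then show "mset u = mset w" "w \<le> u"
    using assms(1) by (force simp: lead_def)+
qed

lemma lead_unique:
  assumes "lead f u" "lead f v"
  shows "u = v"
  using lead_keys(2)[OF assms(1), of v] lead_keys(2)[OF assms(2), of u] assms
  by (auto simp: in_keys_iff lead_lookup)

text \<open>Words of \<open>f\<close> are as long as \<open>u\<close>, so a word \<open>a\<close> of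
  \<open>f\<close> above \<open>u\<close> keeps \<open>a @ b\<close> above \<open>u @ v\<close> for
  every \<open>b\<close>.\<close>

lemma lead_mult:
  assumes f: "lead f u" and g: "lead g v"
  shows "lead (f * g) (u @ v)"
  unfolding lead_def
proof
  fix w assume w: "w \<in> Poly_Mapping.keys (f * g - mon (u @ v))"
  have "f * g - mon (u @ v) = (f - mon u) * g + mon u * (g - mon v)"
    by (simp add: algebra_simps single_mult_single)
  with w consider "w \<in> Poly_Mapping.keys ((f - mon u) * g)"
    | "w \<in> Poly_Mapping.keys (mon u * (g - mon v))"
    using keys_addD by metis
  then show "mset w = mset (u @ v) \<and> u @ v < w"
  proof cases
    case 1
    from keys_multD[OF this] obtain a b
      where "a \<in> Poly_Mapping.keys (f - mon u)" "b \<in> Poly_Mapping.keys g" "w = a @ b"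
      by blast
    moreover from this have a: "mset a = mset u" "u < a"
      using f by (simp_all add: lead_def)
    ultimately show ?thesis
      using lead_keys[OF g, of b] mset_eq_length[OF a(1)] by (simp add: append_less_appendI)
  next
    case 2
    from keys_multD[OF this] obtain b where "b \<in> Poly_Mapping.keys (g - mon v)" "w = u @ b"
      by auto
    then show ?thesis
      using g by (auto simp: lead_def)
  qed
qed

text \<open>All words of \<open>g * f\<close> are at least \<open>v @ u\<close>, hence above
  \<open>u @ v\<close>, and cannot disturb the leading word of \<open>f * g\<close>.\<close>

lemma lead_commutator:
  assumes f: "lead f u" and g: "lead g v" and less: "u @ v < v @ u"
  shows "lead (f * g - g * f) (u @ v)"
  unfolding lead_def
proof
  fix w assume "w \<in> Poly_Mapping.keys (f * g - g * f - mon (u @ v))"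
  then have "w \<in> Poly_Mapping.keys (f * g - mon (u @ v)) \<or> w \<in> Poly_Mapping.keys (g * f)"
    using keys_minusD[of w "f * g - mon (u @ v)" "g * f"] by (simp add: algebra_simps)
  then show "mset w = mset (u @ v) \<and> u @ v < w"
    using lead_mult[OF f g] lead_keys[OF lead_mult[OF g f], of w] less
    by (auto simp: lead_def)
qed

lemma lead_bracketing:
  fixes w :: "'x::linorder list"
  shows "lyndon w \<Longrightarrow> lead (bracketing w :: ('x, 'k::comm_ring_1) free_alg) w"
proof (induction w rule: length_induct)
  case (1 w)
  show ?case
  proof (cases "length w \<le> 1")
    case True
    then show ?thesis
      by (simp add: bracketing.simps[of w] lead_def)
  next
    case False
    then have len: "length w > 1"
      by simp
    let ?u = "std_left w" and ?v = "std_right w"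
    let ?E = "bracketing :: 'x list \<Rightarrow> ('x, 'k) free_alg"
    have uv: "?u @ ?v = w"
      by (rule std_factorization[OF len])
    have lyn: "lyndon ?u" "lyndon ?v"
      using lyndon_std_left[OF 1(2) len] std_right_props(2)[OF len] by simp_all
    then have "lead (?E ?u) ?u" "lead (?E ?v) ?v"
      using std_lengths[OF len] 1(1) by simp_all
    moreover have "?u \<noteq> []" "?v \<noteq> []"
      using lyn by (simp_all add: lyndon_def)
    \<comment> \<open>The rotation condition in the definition of Lyndon words is what decides which
      half of the commutator leads.\<close>
    then have "?u @ ?v < ?v @ ?u"
      using 1(2) uv by (intro lyndon_less_rotation) simp_all
    ultimately have "lead (?E ?u * ?E ?v - ?E ?v * ?E ?u) (?u @ ?v)"
      by (intro lead_commutator)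
    then show ?thesis
      using False uv by (simp add: bracketing.simps[of w])
  qed
qed

text \<open>Repetitions in the list replace the exponents, so one list is both the factorization of
  a word and the index of a basis element.\<close>

definition pbw_prod :: "'x::linorder list list \<Rightarrow> ('x, 'k::comm_ring_1) free_alg" where
  "pbw_prod ls = prod_list (map bracketing ls)"

lemma pbw_prod_Nil [simp]: "pbw_prod [] = 1"
  by (simp add: pbw_prod_def)

lemma pbw_prod_Cons [simp]: "pbw_prod (l # ls) = bracketing l * pbw_prod ls"
  by (simp add: pbw_prod_def)

lemma lead_mon: "lead (mon w) w"
  by (simp add: lead_def)

lemma lead_pbw_prod: "lyndon_seq ls \<Longrightarrow> lead (pbw_prod ls) (concat ls)"
proof (induction ls)
  case Nil
  then show ?case
    using lead_mon[of "[]"] by (simp add: mon_Nil)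
qed (simp add: lyndon_seq_Cons lead_mult lead_bracketing)

lemma pbw_prod_inject:
  assumes "lyndon_seq ls" "lyndon_seq ms"
    and "(pbw_prod ls :: ('x::linorder, 'k::comm_ring_1) free_alg) = pbw_prod ms"
  shows "ls = ms"
proof -
  have "lead (pbw_prod ls :: ('x, 'k) free_alg) (concat ls)"
    by (rule lead_pbw_prod[OF assms(1)])
  moreover have "lead (pbw_prod ls :: ('x, 'k) free_alg) (concat ms)"
    unfolding assms(3) by (rule lead_pbw_prod[OF assms(2)])
  ultimately have "concat ls = concat ms"
    by (rule lead_unique)
  then show ?thesis
    by (rule lyndon_seq_unique[OF assms(1,2)])
qed

text \<open>In a vanishing combination take, among the elements with nonzero coefficient, the one
  with the least leading word. No other element contains that word, and its coefficient there is 1,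
  so no division in \<open>'k\<close> is required.\<close>

lemma independent_if_lead:
  fixes B :: "('x::linorder, 'k::comm_ring_1) free_alg set"
  assumes lead: "\<And>b. b \<in> B \<Longrightarrow> lead b (h b)" and inj: "inj_on h B"
  shows "\<not> free_alg.dependent B"
  unfolding free_alg.independent_explicit_module
proof (intro allI impI)
  fix T and c :: "_ \<Rightarrow> 'k" and v
  assume fin: "finite T" and T: "T \<subseteq> B" and sum: "(\<Sum>b\<in>T. free_scale (c b) b) = 0" and v: "v \<in> T"
  show "c v = 0"
  proof (rule ccontr)
    assume "c v \<noteq> 0"
    define S where "S = {b \<in> T. c b \<noteq> 0}"
    have S: "finite (h ` S)" "h ` S \<noteq> {}"
      using fin v \<open>c v \<noteq> 0\<close> by (auto simp: S_def)
    then obtain b where b: "b \<in> S" "h b = Min (h ` S)"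
      using Min_in by (metis imageE)
    have zero: "c a * Poly_Mapping.lookup a (h b) = 0" if "a \<in> T - {b}" for a
    proof (cases "a \<in> S")
      case True
      have "h b \<le> h a"
        using b S True by simp
      moreover have "h b \<noteq> h a"
        using b that T inj_onD[OF inj, of b a] by (auto simp: S_def)
      ultimately have "h b \<notin> Poly_Mapping.keys a"
        using lead_keys(2)[OF lead, of a "h b"] T that by auto
      then show ?thesis
        by (simp add: in_keys_iff)
    qed (use that in \<open>auto simp: S_def\<close>)
    have "b \<in> T"
      using b by (simp add: S_def)
    have "(\<Sum>a\<in>T. c a * Poly_Mapping.lookup a (h b)) = 0"
      using arg_cong[OF sum, of "\<lambda>f. Poly_Mapping.lookup f (h b)"]
      by (simp add: lookup_sum lookup_free_scale)
    then have "c b * Poly_Mapping.lookup b (h b) = 0"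
      using zero fin \<open>b \<in> T\<close> by (simp add: sum.remove)
    then show False
      using lead_lookup[OF lead, of b] \<open>b \<in> T\<close> T b by (auto simp: S_def)
  qed
qed

lemma finite_words_mset: "finite {w. mset w = M}"
proof (rule finite_subset)
  show "{w. mset w = M} \<subseteq> {w. set w \<subseteq> set_mset M \<and> length w = size M}"
    by auto
qed (rule finite_lists_length_eq, simp)

text \<open>Induction on the number of larger words of the same content: for the Lyndon
  factorization \<open>ls\<close> of \<open>w\<close>, \<open>pbw_prod ls\<close> is
  \<open>mon w\<close> plus such larger words. Keeping the content in the spanning set is what makes
  PBW coefficients respect content.\<close>

lemma mon_in_span_pbw:
  fixes w :: "'x::linorder list"
  shows "(mon w :: ('x, 'k::comm_ring_1) free_alg) \<in>
    free_alg.span (pbw_prod ` {ls. lyndon_seq ls \<and> mset (concat ls) = mset w})"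
proof (induction "card {u. mset u = mset w \<and> w < u}" arbitrary: w rule: less_induct)
  case less
  let ?S = "free_alg.span
    (pbw_prod ` {ls. lyndon_seq ls \<and> mset (concat ls) = mset w} :: ('x, 'k) free_alg set)"
  obtain ls where ls: "lyndon_seq ls" "concat ls = w"
    using lyndon_seq_exists by blast
  define f :: "('x, 'k) free_alg" where "f = pbw_prod ls - mon w"
  have "mon u \<in> ?S" if "u \<in> Poly_Mapping.keys f" for u
  proof -
    have u: "mset u = mset w" "w < u"
      using lead_pbw_prod[OF ls(1)] ls(2) that by (auto simp: lead_def f_def)
    then have "{v. mset v = mset u \<and> u < v} \<subset> {v. mset v = mset w \<and> w < v}"
      by auto
    then have "card {v. mset v = mset u \<and> u < v} < card {v. mset v = mset w \<and> w < v}"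
      by (intro psubset_card_mono) (auto intro: finite_subset[OF _ finite_words_mset])
    then show ?thesis
      using less.hyps[of u] u(1) by simp
  qed
  then have "f \<in> ?S"
    by (subst free_alg_expand[of f]) (intro free_alg.span_sum free_alg.span_scale)
  moreover have "pbw_prod ls \<in> ?S"
    using ls by (auto intro: free_alg.span_base)
  ultimately have "pbw_prod ls - f \<in> ?S"
    by (rule free_alg.span_diff[rotated])
  then show ?case
    by (simp add: f_def)
qed

section \<open>PBW indices as lists, and the basis property\<close>

lemma pbw_monomial_eq_pbw_prod:
  "pbw_monomial n \<alpha> t = pbw_prod (concat (map (\<lambda>k. replicate (t k) (\<alpha> k)) [1..<Suc n]))"
proof -
  have pow: "bracketing l ^ m = pbw_prod (replicate m l)" for l :: "'a list" and m
    by (induction m) simp_all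
  have append: "pbw_prod (ls @ ms) = pbw_prod ls * pbw_prod ms" for ls ms :: "'a list list"
    by (simp add: pbw_prod_def)
  have "(\<Prod>k\<leftarrow>ks. bracketing (\<alpha> k) ^ t k) =
      pbw_prod (concat (map (\<lambda>k. replicate (t k) (\<alpha> k)) ks))" for ks
    by (induction ks) (simp_all add: pow append)
  then show ?thesis
    by (simp only: pbw_monomial_def)
qed

lemma lyndon_seq_of_index:
  assumes "pbw_index n \<alpha> t"
  shows "lyndon_seq (concat (map (\<lambda>k. replicate (t k) (\<alpha> k)) [1..<Suc n]))"
proof -
  have main: "lyndon_seq (concat (map (\<lambda>k. replicate (t k) (\<alpha> k)) ks))"
    if "set ks \<subseteq> {1..n}" "sorted_wrt (<) ks" for ks
    using that
  proof (induction ks)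
    case (Cons k ks)
    have rep: "lyndon_seq (replicate m (\<alpha> k) @ ms)"
      if "lyndon_seq ms" "\<forall>l\<in>set ms. l \<le> \<alpha> k" "lyndon (\<alpha> k)" for m ms
      using that by (induction m) (auto simp: lyndon_seq_Cons)
    have "\<alpha> x \<le> \<alpha> k" if "x \<in> set ks" for x
      by (rule less_imp_le) (use Cons.prems assms that in \<open>auto simp: pbw_index_def subset_iff\<close>)
    then show ?case
      using Cons assms by (auto simp: pbw_index_def intro!: rep)
  qed simp
  show ?thesis
    by (rule main) (auto simp del: upt_Suc)
qed

lemma index_of_lyndon_seq:
  assumes "lyndon_seq ls"
  obtains n \<alpha> t where "pbw_index n \<alpha> t" "concat (map (\<lambda>k. replicate (t k) (\<alpha> k)) [1..<Suc n]) = ls"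
proof -
  define ds where "ds = rev (sorted_list_of_set (set ls))"
  \<comment> \<open>The distinct factors in decreasing order, with their multiplicities as
    exponents. Indices start at 1 and list positions at 0, hence \<open>k - 1\<close>.\<close>
  define n \<alpha> t where "n = length ds" and "\<alpha> = (\<lambda>k. ds ! (k - 1))" and "t = (\<lambda>k. count_list ls (\<alpha> k))"
  have ds: "set ds = set ls" "distinct ds" "sorted_wrt (>) ds"
    using strict_sorted_list_of_set[of "set ls"]
    by (simp_all add: ds_def sorted_wrt_rev)
  have idx: "pbw_index n \<alpha> t"
    unfolding pbw_index_def
  proof (intro conjI ballI impI)
    fix k assume k: "k \<in> {1..n}"
    then have "\<alpha> k \<in> set ls"
      unfolding \<alpha>_def ds(1)[symmetric] by (intro nth_mem) (auto simp: n_def)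
    then have "t k \<noteq> 0"
      unfolding t_def by (simp add: count_list_0_iff)
    then show "1 \<le> t k"
      by simp
    show "lyndon (\<alpha> k)"
      using assms \<open>\<alpha> k \<in> set ls\<close> by (simp add: lyndon_seq_def)
    fix l assume "l \<in> {1..n}" "k < l"
    then have "k - 1 < l - 1" "l - 1 < length ds"
      using k by (auto simp: n_def)
    then show "\<alpha> l < \<alpha> k"
      unfolding \<alpha>_def by (rule sorted_wrt_nth_less[OF ds(3)])
  qed
  let ?ls = "concat (map (\<lambda>k. replicate (t k) (\<alpha> k)) [1..<Suc n])"
  have "map \<alpha> [1..<Suc n] = ds"
    by (intro nth_equalityI) (simp_all add: \<alpha>_def n_def del: upt_Suc)
  then have "?ls = concat (map (\<lambda>d. replicate (count_list ls d) d) ds)"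
    unfolding t_def by (metis (no_types, lifting) map_map comp_apply map_eq_conv)
  also have "mset \<dots> = mset ls"
  proof -
    have "count (mset (concat (map (\<lambda>d. replicate (count_list ls d) d) es))) x =
        (if x \<in> set es then count_list ls x else 0)" if "distinct es" for es x
      using that by (induction es) auto
    then show ?thesis
      using ds by (intro multiset_eqI) (auto simp: count_mset count_list_0_iff)
  qed
  finally have "?ls = ls"
    by (intro lyndon_seq_mset_eq lyndon_seq_of_index[OF idx] assms)
  then show ?thesis
    using that idx by simp
qed

lemma pbw_basis_eq: "pbw_basis = pbw_prod ` {ls. lyndon_seq ls}"
proof (intro equalityI subsetI)
  fix f :: "('a, 'b) free_alg"
  assume "f \<in> pbw_basis"
  then obtain n \<alpha> t where "pbw_index n \<alpha> t" "f = pbw_monomial n \<alpha> t"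
    by (auto simp: pbw_basis_def)
  then show "f \<in> pbw_prod ` {ls. lyndon_seq ls}"
    using lyndon_seq_of_index pbw_monomial_eq_pbw_prod by blast
next
  fix f :: "('a, 'b) free_alg"
  assume "f \<in> pbw_prod ` {ls. lyndon_seq ls}"
  then obtain ls where ls: "lyndon_seq ls" "f = pbw_prod ls"
    by auto
  obtain n \<alpha> t where idx: "pbw_index n \<alpha> t"
    and "concat (map (\<lambda>k. replicate (t k) (\<alpha> k)) [1..<Suc n]) = ls"
    using index_of_lyndon_seq[OF ls(1)] .
  then have "f = pbw_monomial n \<alpha> t"
    unfolding pbw_monomial_eq_pbw_prod ls(2) by (simp only:)
  with idx show "f \<in> pbw_basis"
    unfolding pbw_basis_def by blast
qed

lemma independent_pbw_basis:
  "\<not> free_alg.dependent (pbw_basis :: ('x::linorder, 'k::comm_ring_1) free_alg set)"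
proof (rule independent_if_lead)
  \<comment> \<open>An element has at most one leading word, so \<open>THE\<close> recovers it;
    injectivity on the basis is then uniqueness of the Lyndon factorization.\<close>
  define h :: "('x, 'k) free_alg \<Rightarrow> _" where "h b = (THE w. lead b w)" for b
  have h: "h (pbw_prod ls) = concat ls" if "lyndon_seq ls" for ls
    unfolding h_def
    by (rule the_equality[where P = "lead (pbw_prod ls)"])
      (erule lead_unique[OF _ lead_pbw_prod[OF that]] | rule lead_pbw_prod[OF that])+
  show "lead b (h b)" if "b \<in> pbw_basis" for b
    using that lead_pbw_prod by (auto simp: pbw_basis_eq h)
  show "inj_on h pbw_basis"
    by (auto simp: pbw_basis_eq h intro!: inj_onI dest: lyndon_seq_unique)
qed

lemma span_pbw_basis:
  "free_alg.span pbw_basis = (UNIV :: ('x::linorder, 'k::comm_ring_1) free_alg set)"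
proof (intro equalityI subsetI)
  fix f :: "('x, 'k) free_alg"
  have "(mon w :: ('x, 'k) free_alg) \<in> free_alg.span pbw_basis" for w
    by (rule subsetD[OF free_alg.span_mono mon_in_span_pbw[of w]]) (auto simp: pbw_basis_eq)
  then show "f \<in> free_alg.span pbw_basis"
    by (subst free_alg_expand[of f]) (intro free_alg.span_sum free_alg.span_scale)
qed simp

section \<open>Coefficients with respect to the PBW basis\<close>

lemma pbw_coeff_add: "pbw_coeff (f + g) b = pbw_coeff f b + pbw_coeff g b"
  by (simp add: pbw_coeff_def free_alg.representation_add independent_pbw_basis span_pbw_basis)

lemma pbw_coeff_sum: "pbw_coeff (\<Sum>i\<in>A. f i) b = (\<Sum>i\<in>A. pbw_coeff (f i) b)"
  by (simp add: pbw_coeff_def free_alg.representation_sum independent_pbw_basis span_pbw_basis)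

lemma pbw_coeff_scale: "pbw_coeff (free_scale c f) b = c * pbw_coeff f b"
  by (simp add: pbw_coeff_def free_alg.representation_scale independent_pbw_basis span_pbw_basis)

lemma pbw_coeff_pbw_prod:
  fixes ls ms :: "'x::linorder list list"
  assumes "lyndon_seq ls" "lyndon_seq ms"
  shows "pbw_coeff (pbw_prod ls :: ('x, 'k::comm_ring_1) free_alg) (pbw_prod ms) =
    (if ms = ls then 1 else 0)"
proof -
  have "(pbw_prod ls :: ('x, 'k) free_alg) \<in> pbw_basis"
    using assms(1) by (simp add: pbw_basis_eq)
  moreover have "(pbw_prod ms :: ('x, 'k) free_alg) = pbw_prod ls \<longleftrightarrow> ms = ls"
    using pbw_prod_inject[OF assms(2,1)] by auto
  ultimately show ?thesis
    by (simp add: pbw_coeff_def free_alg.representation_basis independent_pbw_basis)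
qed

text \<open>By \<open>mon_in_span_pbw\<close> the word already has an expansion in PBW products of
  its own content, and by independence this is its expansion in the whole basis.\<close>

lemma pbw_coeff_mon_eq_0:
  fixes w :: "'x::linorder list"
  assumes "lyndon_seq ls" "mset (concat ls) \<noteq> mset w"
  shows "pbw_coeff (mon w :: ('x, 'k::comm_ring_1) free_alg) (pbw_prod ls) = 0"
proof (rule ccontr)
  let ?B = "pbw_prod ` {ls. lyndon_seq ls \<and> mset (concat ls) = mset w} :: ('x, 'k) free_alg set"
  assume "pbw_coeff (mon w :: ('x, 'k) free_alg) (pbw_prod ls) \<noteq> 0"
  moreover have "free_alg.representation pbw_basis (mon w :: ('x, 'k) free_alg) =
      free_alg.representation ?B (mon w)"
    by (rule free_alg.representation_extend[OF independent_pbw_basis mon_in_span_pbw])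
      (auto simp: pbw_basis_eq)
  ultimately have "(pbw_prod ls :: ('x, 'k) free_alg) \<in> ?B"
    by (intro free_alg.representation_ne_zero[of ?B "mon w"]) (simp add: pbw_coeff_def)
  then obtain ms where "(pbw_prod ls :: ('x, 'k) free_alg) = pbw_prod ms"
    and ms: "lyndon_seq ms" "mset (concat ms) = mset w"
    by blast
  then have "ls = ms"
    by (intro pbw_prod_inject[OF assms(1) ms(1)])
  with ms(2) assms(2) show False
    by simp
qed

text \<open>Indexing the expansion by lists rather than by basis elements allows linear maps to be
  evaluated on each \<open>pbw_prod\<close>.\<close>

lemma pbw_expand:
  fixes f :: "('x::linorder, 'k::comm_ring_1) free_alg"
  obtains A where "finite A" "\<And>ls. ls \<in> A \<Longrightarrow> lyndon_seq ls"
    "f = (\<Sum>ls\<in>A. free_scale (pbw_coeff f (pbw_prod ls)) (pbw_prod ls))"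
proof -
  let ?B = "{b. pbw_coeff f b \<noteq> 0}"
  have fin: "finite ?B"
    unfolding pbw_coeff_def by (rule free_alg.finite_representation)
  have "?B \<subseteq> pbw_prod ` {ls. lyndon_seq ls}"
    using free_alg.representation_ne_zero unfolding pbw_coeff_def pbw_basis_eq by blast
  then obtain A where A: "A \<subseteq> {ls. lyndon_seq ls}" "?B = pbw_prod ` A"
    by (auto simp: subset_image_iff)
  have inj: "inj_on (pbw_prod :: _ \<Rightarrow> ('x, 'k) free_alg) A"
    using A(1) pbw_prod_inject by (auto intro!: inj_onI)
  have "f = (\<Sum>b\<in>?B. free_scale (pbw_coeff f b) b)"
    unfolding pbw_coeff_def
    by (rule free_alg.sum_nonzero_representation_eq[symmetric])
      (simp_all add: independent_pbw_basis span_pbw_basis)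
  also have "\<dots> = (\<Sum>ls\<in>A. free_scale (pbw_coeff f (pbw_prod ls)) (pbw_prod ls))"
    unfolding A(2) by (simp add: sum.reindex[OF inj])
  finally show ?thesis
    using that[of A] A fin inj by (auto simp: finite_image_iff)
qed

section \<open>Primitive elements and the coproduct\<close>

text \<open>
  \<open>coprod_with \<phi>\<close> is \<open>(\<phi> \<otimes> id) \<circ> \<Delta>\<close>, where \<open>\<Delta>\<close> is the coproduct making the letters primitive:
  \<open>word_coprod_with \<phi> w\<close> is the sum of \<open>\<phi>(u) v\<close> over all ways of splitting \<open>w\<close> into a subword \<open>u\<close>
  and the complementary subword \<open>v\<close>. Keeping \<open>\<phi>\<close> as a parameter avoids tensor products.
\<close>

primrec word_coprod_with ::
    "(('x, 'k) free_alg \<Rightarrow> 'k) \<Rightarrow> 'x list \<Rightarrow> ('x, 'k::comm_ring_1) free_alg" where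
  "word_coprod_with \<phi> [] = free_scale (\<phi> 1) 1"
| "word_coprod_with \<phi> (x # w) =
     word_coprod_with (\<lambda>g. \<phi> (var x * g)) w + var x * word_coprod_with \<phi> w"

definition coprod_with ::
    "(('x, 'k) free_alg \<Rightarrow> 'k) \<Rightarrow> ('x, 'k) free_alg \<Rightarrow> ('x, 'k::comm_ring_1) free_alg" where
  "coprod_with \<phi> f =
     (\<Sum>w\<in>Poly_Mapping.keys f. free_scale (Poly_Mapping.lookup f w) (word_coprod_with \<phi> w))"

section \<open>Linearity of the coproduct in both arguments\<close>

lemma coprod_with_add: "coprod_with \<phi> (f + g) = coprod_with \<phi> f + coprod_with \<phi> g"
  unfolding coprod_with_def
  by (rule setsum_keys_plus_distrib) (simp_all add: free_alg.scale_left_distrib)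

lemma coprod_with_single:
  "coprod_with \<phi> (Poly_Mapping.single w c) = free_scale c (word_coprod_with \<phi> w)"
  by (simp add: coprod_with_def)

lemma coprod_with_zero: "coprod_with \<phi> 0 = 0"
  by (simp add: coprod_with_def)

lemma coprod_with_one: "coprod_with \<phi> 1 = free_scale (\<phi> 1) 1"
  using coprod_with_single[of \<phi> "[]" 1] by (simp add: mon_Nil)

lemma coprod_with_sum: "coprod_with \<phi> (\<Sum>i\<in>A. f i) = (\<Sum>i\<in>A. coprod_with \<phi> (f i))"
  by (induction A rule: infinite_finite_induct) (simp_all add: coprod_with_zero coprod_with_add)

lemma coprod_with_diff: "coprod_with \<phi> (f - g) = coprod_with \<phi> f - coprod_with \<phi> g"
  using coprod_with_add[of \<phi> "f - g" g] by simp

lemma coprod_with_scale: "coprod_with \<phi> (free_scale c f) = free_scale c (coprod_with \<phi> f)"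
  by (induction f rule: free_alg_induct)
    (simp_all add: free_scale_single coprod_with_single coprod_with_add free_alg.scale_right_distrib)

lemma coprod_with_functional_add:
  "coprod_with (\<lambda>g. \<phi> g + \<psi> g) f = coprod_with \<phi> f + coprod_with \<psi> f"
proof -
  have "word_coprod_with (\<lambda>g. \<phi> g + \<psi> g) w = word_coprod_with \<phi> w + word_coprod_with \<psi> w" for w
    by (induction w arbitrary: \<phi> \<psi>) (simp_all add: free_alg.scale_left_distrib algebra_simps)
  then show ?thesis
    by (simp add: coprod_with_def free_alg.scale_right_distrib sum.distrib)
qed

lemma coprod_with_functional_diff:
  "coprod_with (\<lambda>g. \<phi> g - \<psi> g) f = coprod_with \<phi> f - coprod_with \<psi> f"
  using coprod_with_functional_add[of "\<lambda>g. \<phi> g - \<psi> g" \<psi> f] by (simp add: algebra_simps)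

lemma additive_mult:
  fixes \<phi> :: "'a::ring \<Rightarrow> 'b::ab_group_add"
  shows "additive \<phi> \<Longrightarrow> additive (\<lambda>g. \<phi> (a * g))"
  by (simp add: additive_def distrib_left)

text \<open>This is the equation
  \<open>\<Delta>(a f) = (a \<otimes> 1 + 1 \<otimes> a) \<Delta>(f)\<close> after applying
  \<open>\<phi>\<close> to the left tensor factor. Additivity of \<open>\<phi>\<close> lets sums and
  differences of such \<open>a\<close> be treated termwise.\<close>

definition primitive :: "('x, 'k::comm_ring_1) free_alg \<Rightarrow> bool" where
  "primitive a \<longleftrightarrow> (\<forall>\<phi> f. additive \<phi> \<longrightarrow>
     coprod_with \<phi> (a * f) = coprod_with (\<lambda>g. \<phi> (a * g)) f + a * coprod_with \<phi> f)"

lemma primitiveD: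
  "primitive a \<Longrightarrow> additive \<phi> \<Longrightarrow>
    coprod_with \<phi> (a * f) = coprod_with (\<lambda>g. \<phi> (a * g)) f + a * coprod_with \<phi> f"
  unfolding primitive_def by blast

lemma primitive_letter: "primitive (var x :: ('x, 'k::comm_ring_1) free_alg)"
  unfolding primitive_def
proof (intro allI impI)
  fix \<phi> :: "('x, 'k) free_alg \<Rightarrow> 'k" and f
  show "coprod_with \<phi> (var x * f) = coprod_with (\<lambda>g. \<phi> (var x * g)) f + var x * coprod_with \<phi> f"
    by (induction f rule: free_alg_induct)
      (simp_all add: single_mult_single coprod_with_single coprod_with_add free_scale_mult_right
        free_alg.scale_right_distrib distrib_left add_ac)
qed

lemma primitive_add:
  fixes a b :: "('x, 'k::comm_ring_1) free_alg"
  assumes "primitive a" "primitive b"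
  shows "primitive (a + b)"
  unfolding primitive_def
proof (intro allI impI)
  fix \<phi> :: "('x, 'k) free_alg \<Rightarrow> 'k" and f assume \<phi>: "additive \<phi>"
  have "(\<lambda>g. \<phi> ((a + b) * g)) = (\<lambda>g. \<phi> (a * g) + \<phi> (b * g))"
    using \<phi> by (simp add: additive_def distrib_right)
  then show "coprod_with \<phi> ((a + b) * f) =
      coprod_with (\<lambda>g. \<phi> ((a + b) * g)) f + (a + b) * coprod_with \<phi> f"
    by (simp add: distrib_right coprod_with_add coprod_with_functional_add
        primitiveD[OF assms(1) \<phi>] primitiveD[OF assms(2) \<phi>])
qed

text \<open>Applied to \<open>a * (b * f)\<close> and \<open>b * (a * f)\<close>, the coproduct
  gives four terms each; the two mixed terms are the same in both and cancel in the
  difference.\<close>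

lemma primitive_commutator:
  fixes a b :: "('x, 'k::comm_ring_1) free_alg"
  assumes a: "primitive a" and b: "primitive b"
  shows "primitive (a * b - b * a)"
  unfolding primitive_def
proof (intro allI impI)
  fix \<phi> :: "('x, 'k) free_alg \<Rightarrow> 'k" and f assume \<phi>: "additive \<phi>"
  have prod: "coprod_with \<phi> (c * (d * f)) = coprod_with (\<lambda>g. \<phi> (c * (d * g))) f
      + d * coprod_with (\<lambda>g. \<phi> (c * g)) f
      + c * coprod_with (\<lambda>g. \<phi> (d * g)) f + c * (d * coprod_with \<phi> f)"
    if "primitive c" "primitive d" for c d
    by (simp add: primitiveD[OF that(1) \<phi>] primitiveD[OF that(2) \<phi>]
        primitiveD[OF that(2) additive_mult[OF \<phi>]] distrib_left add_ac)
  have "(\<lambda>g. \<phi> ((a * b - b * a) * g)) = (\<lambda>g. \<phi> (a * (b * g)) - \<phi> (b * (a * g)))"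
    by (simp add: left_diff_distrib additive.diff[OF \<phi>] mult.assoc)
  then show "coprod_with \<phi> ((a * b - b * a) * f) =
      coprod_with (\<lambda>g. \<phi> ((a * b - b * a) * g)) f + (a * b - b * a) * coprod_with \<phi> f"
    by (simp add: left_diff_distrib mult.assoc coprod_with_diff coprod_with_functional_diff
        prod[OF a b] prod[OF b a])
qed

lemma primitive_bracketing:
  fixes w :: "'x::linorder list"
  shows "lyndon w \<Longrightarrow> primitive (bracketing w :: ('x, 'k::comm_ring_1) free_alg)"
proof (induction w rule: length_induct)
  case (1 w)
  show ?case
  proof (cases "length w \<le> 1")
    case True
    with 1(2) obtain x where "w = [x]"
      by (cases w) (auto simp: lyndon_def)
    then show ?thesis
      by (simp add: bracketing_letter primitive_letter)
  next
    case False
    then have len: "length w > 1"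
      by simp
    have "lyndon (std_left w)" "lyndon (std_right w)"
      using lyndon_std_left[OF 1(2) len] std_right_props(2)[OF len] by simp_all
    then show ?thesis
      using std_lengths[OF len] 1(1) False
      by (simp add: bracketing.simps[of w] primitive_commutator)
  qed
qed

text \<open>The binomial theorem for the commuting elements \<open>s \<otimes> 1\<close> and
  \<open>1 \<otimes> s\<close>. The induction varies \<open>\<phi>\<close>, since moving one
  \<open>s\<close> to the left factor replaces \<open>\<phi>\<close> by
  \<open>\<lambda>g. \<phi> (s * g)\<close>.\<close>

lemma coprod_with_power:
  assumes s: "primitive s" and \<phi>: "additive \<phi>"
  shows "coprod_with \<phi> (s ^ n) =
    (\<Sum>m\<le>n. free_scale (of_nat (n choose m) * \<phi> (s ^ m)) (s ^ (n - m)))"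
  using \<phi>
proof (induction n arbitrary: \<phi>)
  case 0
  then show ?case
    by (simp add: coprod_with_one)
next
  case (Suc n)
  let ?T = "\<lambda>c m. free_scale (of_nat c * \<phi> (s ^ m)) (s ^ (Suc n - m))"
  have "s * coprod_with \<phi> (s ^ n) = (\<Sum>m\<le>n. ?T (n choose m) m)"
    by (simp add: Suc sum_distrib_left free_scale_mult_right Suc_diff_le)
  \<comment> \<open>The added term vanishes because \<open>n choose Suc n\<close> is 0; splitting
    off \<open>m = 0\<close> next aligns both sums for Pascal's rule.\<close>
  also have "\<dots> = (\<Sum>m\<le>Suc n. ?T (n choose m) m)"
    by (simp add: binomial_eq_0)
  also have "\<dots> = ?T 1 0 + (\<Sum>m\<le>n. ?T (n choose Suc m) (Suc m))"
    by (subst sum.atMost_Suc_shift) simp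
  finally have "coprod_with \<phi> (s ^ Suc n) =
      ?T 1 0 + ((\<Sum>m\<le>n. ?T (n choose m) (Suc m)) + (\<Sum>m\<le>n. ?T (n choose Suc m) (Suc m)))"
    by (simp add: primitiveD[OF s Suc.prems] Suc.IH[OF additive_mult[OF Suc.prems]] add_ac)
  also have "\<dots> = ?T 1 0 + (\<Sum>m\<le>n. ?T (Suc n choose Suc m) (Suc m))"
    by (simp add: distrib_right free_alg.scale_left_distrib flip: sum.distrib)
  also have "\<dots> = (\<Sum>m\<le>Suc n. ?T (Suc n choose m) m)"
    by (subst sum.atMost_Suc_shift) simp
  finally show ?case .
qed

section \<open>The coproduct of PBW monomials\<close>

lemma lyndon_seq_subseq:
  assumes "subseq ls ms" "lyndon_seq ms"
  shows "lyndon_seq ls"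
  using assms
proof (induction rule: list_emb.induct)
  case (list_emb_Cons2 l m ls ms)
  then show ?case
    by (auto simp: lyndon_seq_Cons dest: list_emb_set)
qed (auto simp: lyndon_seq_Cons)

text \<open>The coproduct of a product of primitive elements distributes the factors over the two
  sides. Here \<open>\<phi>\<close> acts on the left parts like \<open>c\<close> times the counit,
  so only the splitting with empty left part remains.\<close>

lemma coprod_with_pbw_prod_counit:
  fixes \<phi> :: "('x::linorder, 'k::comm_ring_1) free_alg \<Rightarrow> 'k"
  assumes "additive \<phi>" "\<forall>m\<in>set ms. lyndon m"
    and "\<And>ss. subseq ss ms \<Longrightarrow> \<phi> (pbw_prod ss) = (if ss = [] then c else 0)"
  shows "coprod_with \<phi> (pbw_prod ms) = free_scale c (pbw_prod ms)"
  using assms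
proof (induction ms arbitrary: \<phi> c)
  case Nil
  then show ?case
    using Nil(3)[of "[]"] by (simp add: coprod_with_one)
next
  case (Cons m ms)
  \<comment> \<open>With \<open>m\<close> in front the left part is never empty, so the induction
    hypothesis applies with \<open>c\<close> equal to 0.\<close>
  have "coprod_with (\<lambda>g. \<phi> (bracketing m * g)) (pbw_prod ms) = free_scale 0 (pbw_prod ms)"
    by (rule Cons.IH)
      (use Cons.prems additive_mult Cons.prems(3)[of "m # _"] in auto)
  moreover have "coprod_with \<phi> (pbw_prod ms) = free_scale c (pbw_prod ms)"
  proof (rule Cons.IH)
    fix ss assume "subseq ss ms"
    then have "subseq ss (m # ms)"
      by (rule list_emb_Cons)
    then show "\<phi> (pbw_prod ss) = (if ss = [] then c else 0)"
      by (rule Cons.prems(3))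
  qed (use Cons.prems in auto)
  ultimately show ?case
    using Cons.prems(2)
    by (simp add: primitiveD[OF primitive_bracketing Cons.prems(1)] free_scale_mult_right)
qed

lemma additive_pbw_coeff: "additive (\<lambda>f. pbw_coeff f b)"
  by (simp add: additive_def pbw_coeff_add)

text \<open>The left parts are again PBW monomials, and \<open>\<phi>\<close> keeps only
  \<open>[l]\<close>: each occurrence of \<open>l\<close> in \<open>ms\<close> contributes once and
  leaves the remaining factors on the right.\<close>

lemma coprod_with_pbw_prod:
  fixes l :: "'x::linorder list"
  defines "\<phi> \<equiv> \<lambda>f :: ('x, 'k::comm_ring_1) free_alg. pbw_coeff f (pbw_prod [l])"
  assumes l: "lyndon l" and ms: "lyndon_seq ms"
  shows "coprod_with \<phi> (pbw_prod ms) =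
    free_scale (of_nat (count_list ms l)) (pbw_prod (remove1 l ms))"
  using ms
proof (induction ms)
  case Nil
  then show ?case
    using pbw_coeff_pbw_prod[where ?'k = 'k, of "[]" "[l]"] l
    by (simp add: coprod_with_one \<phi>_def lyndon_seq_Cons)
next
  case (Cons m ms)
  have \<phi>: "additive \<phi>"
    by (simp add: \<phi>_def additive_pbw_coeff)
  have m: "lyndon m" "lyndon_seq ms"
    using Cons.prems by (auto simp: lyndon_seq_Cons)
  have "coprod_with (\<lambda>g. \<phi> (bracketing m * g)) (pbw_prod ms) =
      free_scale (if m = l then 1 else 0) (pbw_prod ms)"
  proof (rule coprod_with_pbw_prod_counit)
    fix ss assume "subseq ss ms"
    then have "lyndon_seq (m # ss)"
      using Cons.prems by (intro lyndon_seq_subseq[of "m # ss" "m # ms"]) simp_all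
    then show "\<phi> (bracketing m * pbw_prod ss) = (if ss = [] then if m = l then 1 else 0 else 0)"
      using pbw_coeff_pbw_prod[of "m # ss" "[l]"] l by (auto simp: \<phi>_def lyndon_seq_Cons)
  qed (use m additive_mult[OF \<phi>] in \<open>auto simp: lyndon_seq_def\<close>)
  then have eq: "coprod_with \<phi> (pbw_prod (m # ms)) =
      free_scale (if m = l then 1 else 0) (pbw_prod ms) +
      bracketing m * free_scale (of_nat (count_list ms l)) (pbw_prod (remove1 l ms))"
    using primitiveD[OF primitive_bracketing[OF m(1)] \<phi>] Cons.IH[OF m(2)] by simp
  show ?case
  proof (cases "m = l")
    case True
    \<comment> \<open>All entries of \<open>ms\<close> are at most \<open>l\<close>, so an
      \<open>l\<close> in \<open>ms\<close> is its head, and left multiplication puts the removed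
      factor back in its place.\<close>
    have "bracketing l * pbw_prod (remove1 l ms) = (pbw_prod ms :: ('x, 'k) free_alg)"
      if "l \<in> set ms"
    proof -
      from that obtain k ks where ks: "ms = k # ks"
        by (cases ms) auto
      then have "k = l"
        using Cons.prems True that by (auto simp: lyndon_seq_Cons intro: antisym)
      then show ?thesis
        using ks by simp
    qed
    then have "free_scale (of_nat (count_list ms l)) (bracketing l * pbw_prod (remove1 l ms)) =
        free_scale (of_nat (count_list ms l)) (pbw_prod ms :: ('x, 'k) free_alg)"
      by (cases "l \<in> set ms") (simp_all add: count_notin)
    then show ?thesis
      using True eq by (simp add: free_scale_mult_right free_alg.scale_left_distrib)
  qed (use eq in \<open>simp add: free_scale_mult_right\<close>)
qed

lemma lyndon_seq_remove1: "lyndon_seq ms \<Longrightarrow> lyndon_seq (remove1 l ms)"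
  by (induction ms) (auto simp: lyndon_seq_Cons dest: set_mp[OF set_remove1_subset])

text \<open>Among the monomials of \<open>f\<close> containing \<open>l\<close>, only the one
  indexed by \<open>l # ls\<close> becomes \<open>ls\<close> when one \<open>l\<close> is removed;
  the factor is the multiplicity of \<open>l\<close> in it.\<close>

lemma pbw_coeff_coprod_with:
  fixes f :: "('x::linorder, 'k::comm_ring_1) free_alg"
  assumes ls: "lyndon_seq (l # ls)"
  shows "pbw_coeff (coprod_with (\<lambda>g. pbw_coeff g (pbw_prod [l])) f) (pbw_prod ls) =
    of_nat (Suc (count_list ls l)) * pbw_coeff f (pbw_prod (l # ls))"
proof -
  obtain A where A: "\<And>ms. ms \<in> A \<Longrightarrow> lyndon_seq ms"
    and f: "f = (\<Sum>ms\<in>A. free_scale (pbw_coeff f (pbw_prod ms)) (pbw_prod ms))"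
    using pbw_expand[of f] by blast
  \<comment> \<open>Naming the coefficients keeps the later substitution of the expansion for
    \<open>f\<close> from reaching into them.\<close>
  define c where "c = (\<lambda>ms. pbw_coeff f (pbw_prod ms))"
  have f': "f = (\<Sum>ms\<in>A. free_scale (c ms) (pbw_prod ms))"
    using f by (simp add: c_def)
  have l: "lyndon l" "lyndon_seq ls"
    using ls by (auto simp: lyndon_seq_Cons)
  have "coprod_with (\<lambda>g. pbw_coeff g (pbw_prod [l])) f = (\<Sum>ms\<in>A. free_scale (c ms)
      (free_scale (of_nat (count_list ms l)) (pbw_prod (remove1 l ms))))"
    by (subst f') (simp add: coprod_with_sum coprod_with_scale
        coprod_with_pbw_prod[OF l(1) A, unfolded pbw_prod_Cons pbw_prod_Nil mult_1_right])
  moreover have "pbw_coeff (pbw_prod (remove1 l ms) :: ('x, 'k) free_alg) (pbw_prod ls) =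
      (if ls = remove1 l ms then 1 else 0)" if "ms \<in> A" for ms
  proof (rule pbw_coeff_pbw_prod)
    show "lyndon_seq (remove1 l ms)"
      using A[OF that] by (rule lyndon_seq_remove1)
  qed (rule l(2))
  ultimately have "pbw_coeff (coprod_with (\<lambda>g. pbw_coeff g (pbw_prod [l])) f) (pbw_prod ls) =
      (\<Sum>ms\<in>A. c ms * (of_nat (count_list ms l) * (if ls = remove1 l ms then 1 else 0)))"
    by (simp add: pbw_coeff_sum pbw_coeff_scale mult.assoc cong: sum.cong)
  also have "\<dots> = (\<Sum>ms\<in>A. c ms * (of_nat (Suc (count_list ls l)) * (if l # ls = ms then 1 else 0)))"
  proof (intro sum.cong refl arg_cong[where f = "times (c _)"])
    fix ms assume "ms \<in> A"
    have "l # ls = ms" if "l \<in> set ms" "ls = remove1 l ms"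
      by (rule lyndon_seq_mset_eq) (use ls A[OF \<open>ms \<in> A\<close>] that in simp_all)
    then show "of_nat (count_list ms l) * (if ls = remove1 l ms then 1 else 0) =
        (of_nat (Suc (count_list ls l)) * (if l # ls = ms then 1 else 0) :: 'k)"
    proof (cases "l # ls = ms")
      case True
      then show ?thesis
        by (simp flip: True)
    next
      case False
      then show ?thesis
        using \<open>l \<in> set ms \<Longrightarrow> ls = remove1 l ms \<Longrightarrow> l # ls = ms\<close>
        by (cases "l \<in> set ms") (auto simp: count_notin)
    qed
  qed
  also have "\<dots> = of_nat (Suc (count_list ls l)) * (\<Sum>ms\<in>A. c ms * (if l # ls = ms then 1 else 0))"
    by (simp only: sum_distrib_left mult.left_commute)
  also have "(\<Sum>ms\<in>A. c ms * (if l # ls = ms then 1 else 0)) = pbw_coeff f (pbw_prod (l # ls))"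
    by (subst f') (simp add: pbw_coeff_sum pbw_coeff_scale pbw_coeff_pbw_prod[OF A ls]
        del: pbw_prod_Cons)
  finally show ?thesis .
qed

section \<open>Powers of the sum of the letters\<close>

abbreviation letter_sum :: "(letter, 'k::comm_ring_1) free_alg" where
  "letter_sum \<equiv> var L1 + var L2"

lemma finite_letter_words: "finite {w :: letter list. length w = n}"
proof (rule finite_subset)
  show "{w :: letter list. length w = n} \<subseteq> {w. set w \<subseteq> {L1, L2} \<and> length w = n}"
    using letter.exhaust by blast
qed (rule finite_lists_length_eq, simp)

lemma letter_sum_power:
  "(letter_sum ^ n :: (letter, 'k::comm_ring_1) free_alg) = (\<Sum>w | length w = n. mon w)"
proof (induction n)
  case 0
  have "{w :: letter list. length w = 0} = {[]}"
    by auto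
  then show ?case
    by (simp add: mon_Nil)
next
  case (Suc n)
  let ?W = "{w :: letter list. length w = n}"

  have "{w. length w = Suc n} = Cons L1 ` ?W \<union> Cons L2 ` ?W"
  proof (intro equalityI subsetI)
    fix w :: "letter list" assume "w \<in> {w. length w = Suc n}"
    then obtain x v where "w = x # v" "length v = n"
      by (auto simp: length_Suc_conv)
    then show "w \<in> Cons L1 ` ?W \<union> Cons L2 ` ?W"
      by (cases x) auto
  qed auto
  moreover have "Cons L1 ` ?W \<inter> Cons L2 ` ?W = {}"
    by auto
  ultimately have "(\<Sum>w | length w = Suc n. mon w :: (letter, 'k) free_alg) =
      (\<Sum>w\<in>?W. mon (L1 # w)) + (\<Sum>w\<in>?W. mon (L2 # w))"
    by (simp add: finite_letter_words sum.union_disjoint sum.reindex)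
  also have "\<dots> = letter_sum * (\<Sum>w\<in>?W. mon w)"
    by (simp add: distrib_right sum_distrib_left single_mult_single sum.distrib)
  finally show ?case
    by (simp add: Suc)
qed

section \<open>PBW coefficients of powers and of shuffle type polynomials\<close>

lemma pbw_coeff_letter_sum_power_eq_0:
  assumes "lyndon_seq ls" "length (concat ls) \<noteq> n"
  shows "pbw_coeff (letter_sum ^ n :: (letter, 'k::comm_ring_1) free_alg) (pbw_prod ls) = 0"
proof -
  have "pbw_coeff (mon w :: (letter, 'k) free_alg) (pbw_prod ls) = 0" if "length w = n" for w
    using assms that by (intro pbw_coeff_mon_eq_0) (auto dest: mset_eq_length)
  then show ?thesis
    by (simp add: letter_sum_power pbw_coeff_sum)
qed

lemma SH_eq: "SH i j = (\<Sum>w | count_list w L2 = i \<and> count_list w L1 = j. mon w)"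
proof -
  define h where "h = (\<lambda>b. if b then L2 else L1)"
  have "inj h"
    by (auto simp: h_def inj_on_def)
  have prod: "(\<Prod>b\<leftarrow>w. if b then bracketing [L2] else bracketing [L1]) = mon (map h w)" for w
    by (induction w) (auto simp: h_def bracketing_letter single_mult_single mon_Nil)
  have "bij_betw (map h) {w. count_list w True = i \<and> count_list w False = j}
      {w. count_list w L2 = i \<and> count_list w L1 = j}"
  proof (rule bij_betw_imageI)
    have count: "count_list (map h w) (h b) = count_list w b" for w b
      using \<open>inj h\<close> by (induction w) (auto dest: injD)
    have count': "count_list (map h w) L2 = count_list w True"
      "count_list (map h w) L1 = count_list w False" for w
      using count[of w True] count[of w False] by (simp_all add: h_def)
    have surj: "w \<in> range (map h)" for w
    proof (intro image_eqI)
      show "w = map h (map (\<lambda>x. x = L2) w)"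
        by (induction w) (auto simp: h_def intro: letter.exhaust)
    qed simp
    show "map h ` {w. count_list w True = i \<and> count_list w False = j} =
        {w. count_list w L2 = i \<and> count_list w L1 = j}"
    proof (intro equalityI subsetI)
      fix w assume w: "w \<in> {w. count_list w L2 = i \<and> count_list w L1 = j}"
      obtain v where "w = map h v"
        using surj by blast
      with w show "w \<in> map h ` {w. count_list w True = i \<and> count_list w False = j}"
        by (auto simp: count')
    qed (auto simp: count')
  qed (use \<open>inj h\<close> in \<open>auto intro: inj_on_subset[of _ UNIV]\<close>)
  then show ?thesis
    unfolding SH_def shuffle_poly_def prod by (rule sum.reindex_bij_betw)
qed

lemma length_eq_count_letters: "length w = count_list w L2 + count_list w L1"
proof (induction w)
  case (Cons x w)
  then show ?case
    by (cases x) auto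
qed simp

text \<open>Words of the power outside this bidegree differ in content from \<open>concat ls\<close>
  and contribute nothing. All shuffle type polynomials can thus be replaced by powers of one
  primitive element.\<close>

lemma pbw_coeff_SH:
  assumes "lyndon_seq ls"
  shows "pbw_coeff (SH (count_list (concat ls) L2) (count_list (concat ls) L1)) (pbw_prod ls) =
    pbw_coeff (letter_sum ^ length (concat ls) :: (letter, 'k::comm_ring_1) free_alg) (pbw_prod ls)"
proof -
  let ?i = "count_list (concat ls) L2" and ?j = "count_list (concat ls) L1"

  have "pbw_coeff (mon w :: (letter, 'k) free_alg) (pbw_prod ls) = 0"
    if "\<not> (count_list w L2 = ?i \<and> count_list w L1 = ?j)" for w
    using assms that by (intro pbw_coeff_mon_eq_0) (auto simp flip: count_mset)
  then show ?thesis
    unfolding SH_eq letter_sum_power pbw_coeff_sum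
    by (intro sum.mono_neutral_left[OF finite_letter_words]) (auto simp: length_eq_count_letters)
qed

text \<open>Evaluate the coefficient of \<open>pbw_prod ls\<close> in the coproduct of the power
  twice: by removing a factor \<open>l\<close>, and by the binomial formula.\<close>

lemma pbw_coeff_letter_sum_power_Cons:
  fixes ls :: "letter list list"
  defines "K \<equiv> \<lambda>ls. pbw_coeff (letter_sum ^ length (concat ls) :: (letter, 'k::comm_ring_1) free_alg)
    (pbw_prod ls)"
  assumes ls: "lyndon_seq (l # ls)"
  shows "of_nat (Suc (count_list ls l)) * K (l # ls) =
    of_nat (length (concat (l # ls)) choose length l) * K [l] * K ls"
proof -
  let ?s = "letter_sum :: (letter, 'k) free_alg"
  let ?n = "length (concat (l # ls))"
  let ?\<phi> = "\<lambda>g :: (letter, 'k) free_alg. pbw_coeff g (pbw_prod [l])"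
  have l: "lyndon_seq [l]" "lyndon_seq ls"
    using ls by (auto simp: lyndon_seq_Cons)
  have "of_nat (Suc (count_list ls l)) * K (l # ls) =
      pbw_coeff (coprod_with ?\<phi> (?s ^ ?n)) (pbw_prod ls)"
    unfolding K_def by (rule pbw_coeff_coprod_with[OF ls, symmetric])
  also have "\<dots> = (\<Sum>m\<le>?n. of_nat (?n choose m) * ?\<phi> (?s ^ m) *
      pbw_coeff (?s ^ (?n - m)) (pbw_prod ls))"
    by (subst coprod_with_power)
      (simp_all only: primitive_add primitive_letter additive_pbw_coeff pbw_coeff_sum pbw_coeff_scale)
  \<comment> \<open>By homogeneity \<open>?\<phi>\<close> vanishes on \<open>?s ^ m\<close> unless
    \<open>m\<close> is the length of \<open>l\<close>.\<close>
  also have "\<dots> = (\<Sum>m\<in>{length l}. of_nat (?n choose m) * ?\<phi> (?s ^ m) *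
      pbw_coeff (?s ^ (?n - m)) (pbw_prod ls))"
    using pbw_coeff_letter_sum_power_eq_0[where ?'k = 'k, OF l(1)]
    by (intro sum.mono_neutral_right) auto
  also have "\<dots> = of_nat (?n choose length l) * K [l] * K ls"
    by (simp add: K_def)
  finally show ?thesis .
qed

text \<open>In the rationals the recurrence can be divided by the multiplicity. The binomial
  coefficients then telescope to a multinomial, and the divisors accumulate to the factorials of the
  multiplicities.\<close>

lemma pbw_coeff_letter_sum_power:
  defines "K \<equiv> \<lambda>ls. rat_of_int (pbw_coeff (letter_sum ^ length (concat ls)) (pbw_prod ls))"
  assumes "lyndon_seq ls"
  shows "K ls = fact (length (concat ls)) *
    (\<Prod>l\<leftarrow>ls. K [l] / fact (length l)) / (\<Prod>l\<in>set ls. fact (count_list ls l))"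
  using assms(2)
proof (induction ls)
  case Nil
  then show ?case
    using pbw_coeff_pbw_prod[where ?'k = int, of "[] :: letter list list" "[]"] by (simp add: K_def)
next
  case (Cons l ls)
  let ?n = "length (concat ls)"
  let ?P = "\<lambda>ls :: letter list list. \<Prod>l\<in>set ls. fact (count_list ls l) :: rat"
  let ?S = "of_nat (Suc (count_list ls l)) :: rat"
  have "?S * K (l # ls) = of_nat ((length l + ?n) choose length l) * K [l] * K ls"
    using arg_cong[OF pbw_coeff_letter_sum_power_Cons[where ?'k = int, OF Cons.prems], of rat_of_int]
    by (simp add: K_def)
  also have "of_nat ((length l + ?n) choose length l) =
      (fact (length l + ?n) / (fact (length l) * fact ?n) :: rat)"
    by (simp add: binomial_fact)
  also have "K ls = fact ?n * (\<Prod>l\<leftarrow>ls. K [l] / fact (length l)) / ?P ls"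
    using Cons by (simp add: lyndon_seq_Cons)
  finally have "?S * K (l # ls) =
      fact (length l + ?n) * (\<Prod>l\<leftarrow>l # ls. K [l] / fact (length l)) / ?P ls"
    by simp
  \<comment> \<open>Only the factorial belonging to \<open>l\<close> changes. If \<open>l\<close> is
    new, its factor is \<open>fact 1\<close> and \<open>?S\<close> is 1.\<close>
  moreover have "?P (l # ls) = ?S * ?P ls"
  proof (cases "l \<in> set ls")
    case True
    then have "?P (l # ls) =
        fact (Suc (count_list ls l)) * (\<Prod>k\<in>set ls - {l}. fact (count_list (l # ls) k))"
      by (simp add: insert_absorb prod.remove[of _ l])
    also have "(\<Prod>k\<in>set ls - {l}. fact (count_list (l # ls) k) :: rat) =
        (\<Prod>k\<in>set ls - {l}. fact (count_list ls k))"
      by (intro prod.cong) auto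
    also have "fact (Suc (count_list ls l)) * \<dots> = ?S * ?P ls"
      using True by (simp add: prod.remove[of _ l])
    finally show ?thesis .
  next
    case False
    then have "?P (l # ls) = (\<Prod>k\<in>set ls. fact (count_list (l # ls) k))"
      by (simp add: count_notin)
    also have "\<dots> = ?P ls"
      using False by (intro prod.cong) auto
    finally show ?thesis
      using False by (simp add: count_notin)
  qed
  moreover have "K (l # ls) = ?S * K (l # ls) / ?S"
    by (simp del: of_nat_Suc)
  ultimately show ?case
    by (simp del: of_nat_Suc prod_list.Cons list.map set_simps)
qed

section \<open>Change of coefficients\<close>

definition of_int_alg :: "('x, int) free_alg \<Rightarrow> ('x, 'k::comm_ring_1) free_alg" where
  "of_int_alg f = Poly_Mapping.map of_int f"

lemma lookup_of_int_alg: "Poly_Mapping.lookup (of_int_alg f) w = of_int (Poly_Mapping.lookup f w)"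
  by (simp add: of_int_alg_def Poly_Mapping.map.rep_eq when_def)

lemma of_int_alg_add: "of_int_alg (f + g) = of_int_alg f + of_int_alg g"
  by (intro poly_mapping_eqI) (simp add: lookup_of_int_alg lookup_add)

lemma of_int_alg_diff: "of_int_alg (f - g) = of_int_alg f - of_int_alg g"
  by (intro poly_mapping_eqI) (simp add: lookup_of_int_alg lookup_minus)

lemma of_int_alg_sum: "of_int_alg (\<Sum>i\<in>A. f i) = (\<Sum>i\<in>A. of_int_alg (f i))"
  by (intro poly_mapping_eqI) (simp add: lookup_of_int_alg lookup_sum)

lemma of_int_alg_scale: "of_int_alg (free_scale c f) = free_scale (of_int c) (of_int_alg f)"
  by (intro poly_mapping_eqI) (simp add: lookup_of_int_alg lookup_free_scale)

lemma of_int_alg_single: "of_int_alg (Poly_Mapping.single w c) = Poly_Mapping.single w (of_int c)"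
  by (intro poly_mapping_eqI) (simp add: lookup_of_int_alg lookup_single when_def)

lemma of_int_alg_mult: "of_int_alg (f * g) = of_int_alg f * of_int_alg g"
proof (induction f rule: free_alg_induct)
  case (single u a)
  show ?case
    by (induction g rule: free_alg_induct)
      (simp_all add: single_mult_single of_int_alg_single of_int_alg_add distrib_left)
qed (simp add: of_int_alg_add distrib_right)

lemma of_int_alg_bracketing: "of_int_alg (bracketing w) = bracketing w"
proof (induction w rule: length_induct)
  case (1 w)
  then show ?case
    using std_lengths[of w]
    by (simp add: bracketing.simps[of w] of_int_alg_single of_int_alg_diff of_int_alg_mult)
qed

lemma of_int_alg_pbw_prod: "of_int_alg (pbw_prod ls) = pbw_prod ls"
proof (induction ls)
  case Nil
  show ?case
    using of_int_alg_single[of "[]" 1] by (simp add: mon_Nil)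
qed (simp add: of_int_alg_mult of_int_alg_bracketing)

text \<open>The coefficient map sends each integral PBW monomial to the one over \<open>'k\<close>
  with the same index, so it carries the integral expansion to the expansion over
  \<open>'k\<close>.\<close>

lemma pbw_coeff_of_int_alg:
  fixes f :: "('x::linorder, int) free_alg"
  assumes "lyndon_seq ls"
  shows "pbw_coeff (of_int_alg f :: ('x, 'k::comm_ring_1) free_alg) (pbw_prod ls) =
    of_int (pbw_coeff f (pbw_prod ls))"
proof -
  obtain A where A: "\<And>ms. ms \<in> A \<Longrightarrow> lyndon_seq ms"
    and f: "f = (\<Sum>ms\<in>A. free_scale (pbw_coeff f (pbw_prod ms)) (pbw_prod ms))"
    using pbw_expand[of f] by blast
  define c where "c = (\<lambda>ms. pbw_coeff f (pbw_prod ms))"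
  have f': "f = (\<Sum>ms\<in>A. free_scale (c ms) (pbw_prod ms))"
    using f by (simp add: c_def)
  have "pbw_coeff (of_int_alg f :: ('x, 'k) free_alg) (pbw_prod ls) =
      (\<Sum>ms\<in>A. of_int (c ms) * (if ls = ms then 1 else 0))"
    by (subst f') (simp add: of_int_alg_sum of_int_alg_scale of_int_alg_pbw_prod pbw_coeff_sum
        pbw_coeff_scale pbw_coeff_pbw_prod[OF A assms])
  also have "\<dots> = of_int (\<Sum>ms\<in>A. c ms * (if ls = ms then 1 else 0))"
    by (simp add: if_distrib[of of_int] cong: if_cong)
  also have "(\<Sum>ms\<in>A. c ms * (if ls = ms then 1 else 0)) = pbw_coeff f (pbw_prod ls)"
    by (subst f') (simp add: pbw_coeff_sum pbw_coeff_scale pbw_coeff_pbw_prod[OF A assms])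
  finally show ?thesis .
qed

lemma of_int_alg_SH: "of_int_alg (SH i j) = SH i j"
  by (simp add: SH_eq of_int_alg_sum of_int_alg_single)

section \<open>The coefficient formula\<close>

text \<open>A nonzero coefficient expresses that the monomial is a term. The quotient is taken in
  the rationals, as its denominators may vanish in \<open>'k\<close>; the last conjunct transfers
  the resulting integer to \<open>'k\<close>.\<close>

theorem theoremA:
  fixes i j n :: nat and \<alpha> :: "nat \<Rightarrow> letter list" and t :: "nat \<Rightarrow> nat"
  assumes "pbw_index n \<alpha> t"
    and "i = (\<Sum>k=1..n. t k * count_list (\<alpha> k) L2)"
    and "j = (\<Sum>k=1..n. t k * count_list (\<alpha> k) L1)"
  shows "(pbw_coeff (SH i j :: (letter, int) free_alg) (pbw_monomial n \<alpha> t) \<noteq> 0 \<longrightarrow>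
        rat_of_int (pbw_coeff (SH i j) (pbw_monomial n \<alpha> t)) =
          fact (i + j) / (\<Prod>k=1..n. fact (length (\<alpha> k)) ^ t k * fact (t k)) *
          (\<Prod>k=1..n. rat_of_int
            (pbw_coeff (SH (count_list (\<alpha> k) L2) (count_list (\<alpha> k) L1))
              (bracketing (\<alpha> k))) ^ t k))
    \<and> i + j = (\<Sum>k=1..n. length (\<alpha> k) * t k)
    \<and> pbw_coeff (SH i j :: (letter, 'k::field) free_alg) (pbw_monomial n \<alpha> t) =
        of_int (pbw_coeff (SH i j :: (letter, int) free_alg) (pbw_monomial n \<alpha> t))"
proof -
  define ls where "ls = concat (map (\<lambda>k. replicate (t k) (\<alpha> k)) [1..<Suc n])"
  define K where
    "K ls = rat_of_int (pbw_coeff (letter_sum ^ length (concat ls)) (pbw_prod ls))" for ls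
  have ls: "lyndon_seq ls"
    unfolding ls_def by (rule lyndon_seq_of_index[OF assms(1)])
  have mono: "pbw_monomial n \<alpha> t = pbw_prod ls"
    unfolding ls_def by (rule pbw_monomial_eq_pbw_prod)
  have set: "set [1..<Suc n] = {1..n}"
    by auto
  have count: "count_list (concat ls) x = (\<Sum>k=1..n. t k * count_list (\<alpha> k) x)" for x
  proof -
    have "count_list (concat (replicate m w)) x = m * count_list w x" for m and w :: "letter list"
      by (induction m) auto
    then have "count_list (concat (concat (map (\<lambda>k. replicate (t k) (\<alpha> k)) ks))) x =
        (\<Sum>k\<leftarrow>ks. t k * count_list (\<alpha> k) x)" for ks
      by (induction ks) auto
    then show ?thesis
      unfolding ls_def by (simp only: sum_list_distinct_conv_sum_set[OF distinct_upt] set)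
  qed
  have ij: "i = count_list (concat ls) L2" "j = count_list (concat ls) L1"
    using assms(2,3) count by simp_all
  have len: "length (concat ls) = i + j"
    by (simp only: ij length_eq_count_letters)
  have deg: "i + j = (\<Sum>k=1..n. length (\<alpha> k) * t k)"
    unfolding assms(2,3)
    by (simp add: length_eq_count_letters algebra_simps sum.distrib)
  have prod: "(\<Prod>l\<leftarrow>ls. g l) = (\<Prod>k=1..n. g (\<alpha> k) ^ t k)" for g :: "letter list \<Rightarrow> rat"
  proof -
    have "prod_list (map g (replicate m w)) = g w ^ m" for m w
      by (induction m) simp_all
    then have "(\<Prod>l\<leftarrow>concat (map (\<lambda>k. replicate (t k) (\<alpha> k)) ks). g l) =
        (\<Prod>k\<leftarrow>ks. g (\<alpha> k) ^ t k)" for ks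
      by (induction ks) auto
    then show ?thesis
      unfolding ls_def by (simp only: prod.distinct_set_conv_list[OF distinct_upt, symmetric] set)
  qed
  \<comment> \<open>Distinct indices carry distinct words, so the multiplicity of
    \<open>\<alpha> k\<close> in \<open>ls\<close> is exactly \<open>t k\<close>.\<close>
  have inj: "inj_on \<alpha> {1..n}"
  proof (rule linorder_inj_onI')
    fix k l assume "k \<in> {1..n}" "l \<in> {1..n}" "k < l"
    then have "\<alpha> l < \<alpha> k"
      using assms(1) unfolding pbw_index_def by blast
    then show "\<alpha> k \<noteq> \<alpha> l"
      by simp
  qed
  have "count_list (concat (map (\<lambda>k. replicate (t k) (\<alpha> k)) ks)) (\<alpha> m) =
      (if m \<in> set ks then t m else 0)" if "distinct ks" "set ks \<subseteq> {1..n}" "m \<in> {1..n}" for ks m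
  proof -
    have "count_list (replicate r w) x = (if x = w then r else 0)" for r and w x :: "letter list"
      by (induction r) auto
    then show ?thesis
      using that by (induction ks) (auto dest: inj_onD[OF inj])
  qed
  then have mult: "count_list ls (\<alpha> k) = t k" if "k \<in> {1..n}" for k
    using that unfolding ls_def by (simp del: upt_Suc add: atLeastLessThanSuc_atLeastAtMost)
  \<comment> \<open>Positive exponents ensure that every \<open>\<alpha> k\<close> really occurs in
    \<open>ls\<close>.\<close>
  have "t k \<noteq> 0" if "k \<in> {1..n}" for k
  proof -
    have "t k \<ge> 1"
      using assms(1) that unfolding pbw_index_def by blast
    then show ?thesis
      by simp
  qed
  then have set_ls: "set ls = \<alpha> ` {1..n}"
    unfolding ls_def by (auto simp: set)
  then have facts: "(\<Prod>l\<in>set ls. fact (count_list ls l)) = (\<Prod>k=1..n. fact (t k) :: rat)"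
    unfolding set_ls prod.reindex[OF inj] by (intro prod.cong) (simp_all add: mult)
  \<comment> \<open>On one-element lists \<open>K\<close> is the constant attached to a single
    Lyndon word in the formula.\<close>
  have K_single: "K [\<alpha> k] = rat_of_int (pbw_coeff
      (SH (count_list (\<alpha> k) L2) (count_list (\<alpha> k) L1)) (bracketing (\<alpha> k)))" if "k \<in> {1..n}" for k
    using assms(1) that pbw_coeff_SH[where ?'k = int, of "[\<alpha> k]"]
    by (simp add: K_def pbw_index_def lyndon_seq_Cons)
  have K_ls: "K ls = fact (length (concat ls)) *
      (\<Prod>l\<leftarrow>ls. K [l] / fact (length l)) / (\<Prod>l\<in>set ls. fact (count_list ls l))"
    unfolding K_def by (rule pbw_coeff_letter_sum_power[OF ls])
  have "rat_of_int (pbw_coeff (SH i j) (pbw_monomial n \<alpha> t)) = K ls"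
    unfolding mono K_def ij by (simp only: pbw_coeff_SH[OF ls])
  also have "\<dots> = fact (i + j) * (\<Prod>k=1..n. (K [\<alpha> k] / fact (length (\<alpha> k))) ^ t k) /
      (\<Prod>k=1..n. fact (t k))"
    unfolding K_ls len prod facts ..
  also have "\<dots> = fact (i + j) / (\<Prod>k=1..n. fact (length (\<alpha> k)) ^ t k * fact (t k)) *
      (\<Prod>k=1..n. K [\<alpha> k] ^ t k)"
    by (simp add: power_divide prod_dividef prod.distrib)
  also have "(\<Prod>k=1..n. K [\<alpha> k] ^ t k) = (\<Prod>k=1..n. rat_of_int
      (pbw_coeff (SH (count_list (\<alpha> k) L2) (count_list (\<alpha> k) L1)) (bracketing (\<alpha> k))) ^ t k)"
    by (intro prod.cong) (simp_all add: K_single)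
  finally show ?thesis
    using deg pbw_coeff_of_int_alg[where ?'k = 'k, OF ls, of "SH i j"]
    by (simp only: mono of_int_alg_SH simp_thms)
qed

end
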